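(* Let $F:[0,\infty)\to\mathcal{L}(\mathfrak{H})$ be a measurable family of non-negative self-adjoint contractions on a Hilbert space $\mathfrak{H}$ such that $F(0)=\mathds{1}$. For $\tau>0$ put $S(\tau):=(\mathds{1}-F(\tau))/\tau$, and let $H$ be a self-adjoint operator in $\mathfrak{H}$ with $H\ge\mu\mathds{1}$ for some $\mu>0$, such that $\operatorname{s-lim}_{\tau\to+0}(\mathds{1}+S(\tau))^{-1}=(\mathds{1}+H)^{-1}$. Assume that for any $\varepsilon>0$ there exists $\delta_\varepsilon\in(0,1)$ such that $$0\le F(\tau)\le(1-\delta_\varepsilon)\mathds{1}\qquad\text{for all }\tau\ge\varepsilon.$$ If there are $\varepsilon_0\in(0,1]$ and a constant $M_1>0$ such that $$\|(\mathds{1}+S(\tau))^{-1}-(\mathds{1}+H)^{-1}\|\le M_1\tau\qquad\text{for all }\tau\in(0,\varepsilon_0),$$ then there exists a constant $c_1>0$ such that $$\sup_{t\in[0,\infty)}\|F(t/n)^n-e^{-tH}\|\le c_1\,\frac1n$$ for all integers $n\ge1$.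
   Context: $\mathcal{L}(\mathfrak{H})$ is the space of bounded linear operators on $\mathfrak{H}$, $\|\cdot\|$ is the operator norm, $\mathds{1}$ is the identity operator, and $\operatorname{s-lim}$ denotes the limit in the strong operator topology. *)

theory Defs
  imports "HOL-Analysis.Analysis"
begin

text \<open>
  A complex Hilbert space is a real Hilbert space (which supplies norm and topology) together with
  a compatible complex structure. As \<open>scaleR\<close> is multiplication by real scalars and the real
  inner product is the real part of \<open>cinner\<close>, the norm satisfies \<open>(norm x)^2 = cinner x x\<close>.
  The form \<open>cinner\<close> is antilinear in its first and linear in its second argument.
\<close>

class complex_hilbert = real_inner + complete_space +
  fixes scaleC :: "complex \<Rightarrow> 'a \<Rightarrow> 'a" (infixr \<open>*\<^sub>C\<close> 75)
    and cinner :: "'a \<Rightarrow> 'a \<Rightarrow> complex"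
  assumes scaleC_add_right: "c *\<^sub>C (x + y) = c *\<^sub>C x + c *\<^sub>C y"
    and scaleC_add_left: "(c + d) *\<^sub>C x = c *\<^sub>C x + d *\<^sub>C x"
    and scaleC_scaleC: "c *\<^sub>C (d *\<^sub>C x) = (c * d) *\<^sub>C x"
    and scaleR_scaleC: "r *\<^sub>R x = complex_of_real r *\<^sub>C x"
    and cinner_commute: "cinner x y = cnj (cinner y x)"
    and cinner_add_right: "cinner x (y + z) = cinner x y + cinner x z"
    and cinner_scaleC_right: "cinner x (c *\<^sub>C y) = c * cinner x y"
    and inner_eq_Re_cinner: "inner x y = Re (cinner x y)"

instantiation complex :: complex_hilbert
begin

definition scaleC_complex :: "complex \<Rightarrow> complex \<Rightarrow> complex"
  where "scaleC_complex c x = c * x"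

definition cinner_complex :: "complex \<Rightarrow> complex \<Rightarrow> complex"
  where "cinner_complex x y = cnj x * y"

instance
  by standard
    (auto simp: scaleC_complex_def cinner_complex_def algebra_simps inner_complex_def scaleR_conv_of_real)

end


section \<open>Bounded operators\<close>

text \<open>
  The type \<open>'a \<Rightarrow>\<^sub>L 'a\<close> consists of the bounded \<^emph>\<open>real\<close>-linear maps; its norm is the operator norm.
  The bounded operators on the complex space are those that commute with complex scalars.
\<close>

definition bounded_operators :: "('a::complex_hilbert \<Rightarrow>\<^sub>L 'a) set" where
  "bounded_operators = {A. \<forall>c x. blinfun_apply A (c *\<^sub>C x) = c *\<^sub>C blinfun_apply A x}"

definition bounded_self_adjoint :: "('a::complex_hilbert \<Rightarrow>\<^sub>L 'a) \<Rightarrow> bool" where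
  "bounded_self_adjoint A \<longleftrightarrow> A \<in> bounded_operators \<and>
     (\<forall>x y. cinner (blinfun_apply A x) y = cinner x (blinfun_apply A y))"

definition op_nonneg :: "('a::complex_hilbert \<Rightarrow>\<^sub>L 'a) \<Rightarrow> bool" where
  "op_nonneg A \<longleftrightarrow> bounded_self_adjoint A \<and> (\<forall>x. 0 \<le> Re (cinner x (blinfun_apply A x)))"

definition op_le :: "('a::complex_hilbert \<Rightarrow>\<^sub>L 'a) \<Rightarrow> ('a \<Rightarrow>\<^sub>L 'a) \<Rightarrow> bool" where
  "op_le A B \<longleftrightarrow> op_nonneg (B - A)"

definition op_power :: "('a::complex_hilbert \<Rightarrow>\<^sub>L 'a) \<Rightarrow> nat \<Rightarrow> ('a \<Rightarrow>\<^sub>L 'a)" where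
  "op_power A n = ((\<lambda>B. A o\<^sub>L B) ^^ n) id_blinfun"

definition strong_limit ::
  "('b \<Rightarrow> ('a::complex_hilbert \<Rightarrow>\<^sub>L 'a)) \<Rightarrow> ('a \<Rightarrow>\<^sub>L 'a) \<Rightarrow> 'b filter \<Rightarrow> bool" where
  "strong_limit G A \<F> \<longleftrightarrow>
     (\<forall>x. ((\<lambda>\<tau>. blinfun_apply (G \<tau>) x) \<longlongrightarrow> blinfun_apply A x) \<F>)"

text \<open>
  Measurability in the weak sense, with respect to the Lebesgue sigma-algebra of the half-line.
  This is implied by strong and by norm measurability (and is equivalent to strong measurability
  on a separable space).
\<close>

definition measurable_family :: "(real \<Rightarrow> ('a::complex_hilbert \<Rightarrow>\<^sub>L 'a)) \<Rightarrow> bool" where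
  "measurable_family F \<longleftrightarrow>
     (\<forall>x y. (\<lambda>t. cinner x (blinfun_apply (F t) y)) \<in> borel_measurable (lebesgue_on {0..}))"


section \<open>Unbounded operators\<close>

text \<open>A possibly unbounded operator is given by its graph.\<close>

type_synonym 'a operator = "('a \<times> 'a) set"

definition linear_operator :: "'a::complex_hilbert operator \<Rightarrow> bool" where
  "linear_operator A \<longleftrightarrow> single_valued A \<and> (0, 0) \<in> A \<and>
     (\<forall>x y u v. (x, y) \<in> A \<longrightarrow> (u, v) \<in> A \<longrightarrow> (x + u, y + v) \<in> A) \<and>
     (\<forall>c x y. (x, y) \<in> A \<longrightarrow> (c *\<^sub>C x, c *\<^sub>C y) \<in> A)"

definition densely_defined :: "'a::complex_hilbert operator \<Rightarrow> bool" where
  "densely_defined A \<longleftrightarrow> closure (Domain A) = UNIV"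

definition adjoint_operator :: "'a::complex_hilbert operator \<Rightarrow> 'a operator" where
  "adjoint_operator A = {(u, v). \<forall>x y. (x, y) \<in> A \<longrightarrow> cinner u y = cinner v x}"

definition self_adjoint :: "'a::complex_hilbert operator \<Rightarrow> bool" where
  "self_adjoint A \<longleftrightarrow> linear_operator A \<and> densely_defined A \<and> adjoint_operator A = A"

definition bounded_below :: "'a::complex_hilbert operator \<Rightarrow> real \<Rightarrow> bool" where
  "bounded_below A \<mu> \<longleftrightarrow> (\<forall>x y. (x, y) \<in> A \<longrightarrow> \<mu> * (norm x)\<^sup>2 \<le> Re (cinner x y))"

definition graph_of :: "('a::complex_hilbert \<Rightarrow>\<^sub>L 'a) \<Rightarrow> 'a operator" where
  "graph_of B = {(x, blinfun_apply B x) | x. True}"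

definition id_plus :: "'a::complex_hilbert operator \<Rightarrow> 'a operator" where
  "id_plus A = {(x, x + y) | x y. (x, y) \<in> A}"

definition op_minus :: "'a::complex_hilbert operator \<Rightarrow> 'a operator" where
  "op_minus A = {(x, - y) | x y. (x, y) \<in> A}"

text \<open>
  The everywhere defined bounded inverse; meaningful only for a boundedly invertible operator,
  such as \<open>id_plus A\<close> with \<open>A\<close> self-adjoint and non-negative.
\<close>

definition bounded_inverse :: "'a::complex_hilbert operator \<Rightarrow> ('a \<Rightarrow>\<^sub>L 'a)" where
  "bounded_inverse A = (THE B. graph_of B = A\<inverse>)"


section \<open>Operator semigroups\<close>

definition C0_semigroup :: "(real \<Rightarrow> ('a::complex_hilbert \<Rightarrow>\<^sub>L 'a)) \<Rightarrow> bool" where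
  "C0_semigroup T \<longleftrightarrow>
     (\<forall>t\<ge>0. T t \<in> bounded_operators) \<and> T 0 = id_blinfun \<and>
     (\<forall>s\<ge>0. \<forall>t\<ge>0. T (s + t) = T s o\<^sub>L T t) \<and>
     strong_limit T id_blinfun (at_right 0)"

definition generator :: "(real \<Rightarrow> ('a::complex_hilbert \<Rightarrow>\<^sub>L 'a)) \<Rightarrow> 'a operator" where
  "generator T =
     {(x, y). ((\<lambda>h. (blinfun_apply (T h) x - x) /\<^sub>R h) \<longlongrightarrow> y) (at_right 0)}"

text \<open>
  \<open>exp_semigroup A t\<close> is the operator \<open>exp (t A)\<close> for \<open>t \<ge> 0\<close>: the value at \<open>t\<close> of the strongly
  continuous semigroup generated by \<open>A\<close>, which is determined by \<open>A\<close>. For \<open>A = op_minus H\<close> with \<open>H\<close>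
  self-adjoint and bounded below the semigroup exists and agrees with the functional calculus.
\<close>

definition exp_semigroup :: "'a::complex_hilbert operator \<Rightarrow> real \<Rightarrow> ('a \<Rightarrow>\<^sub>L 'a)" where
  "exp_semigroup A t = (THE B. \<exists>T. C0_semigroup T \<and> generator T = A \<and> B = T t)"


section \<open>The operators \<open>S(\<tau>)\<close> of a family\<close>

definition chernoff_quotient ::
  "(real \<Rightarrow> ('a::complex_hilbert \<Rightarrow>\<^sub>L 'a)) \<Rightarrow> real \<Rightarrow> ('a \<Rightarrow>\<^sub>L 'a)" where
  "chernoff_quotient F \<tau> = (id_blinfun - F \<tau>) /\<^sub>R \<tau>"

end

theory Submission imports Defs begin

text \<open>
  Write \<open>K\<close> for the inverse of \<open>H\<close> and \<open>R(\<tau>)\<close> for the resolvent \<open>(1 + \<tau> H)\<^sup>-\<^sup>1\<close>. Everything is derived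
  from one inequality for positive contractions \<open>P\<close> and \<open>Q\<close>. If \<open>1 - P\<close> and \<open>1 - Q\<close> are invertible
  and \<open>D\<close> is the difference of their inverses, then \<open>P - Q = (1 - P) D (1 - Q)\<close>, and this
  factorization gives \<open>\<parallel>P\<^sup>n - Q\<^sup>n\<parallel> \<le> 80 \<parallel>D\<parallel> / n\<close> (\<open>norm_power_minus_power_le\<close>).

  For \<open>P = F(\<tau>)\<close> and \<open>Q = R(\<tau>)\<close> one has \<open>D = (S(\<tau>)\<^sup>-\<^sup>1 - K) / \<tau> - 1\<close>. The hypotheses imply
  that \<open>D\<close> is bounded uniformly in \<open>\<tau> > 0\<close>: near \<open>0\<close> the rate of convergence of the resolvents at
  \<open>1\<close> is inherited by the inverses (\<open>norm_inverse_difference_le\<close>), and away from \<open>0\<close> the gap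
  condition bounds \<open>(1 - F(\<tau>))\<^sup>-\<^sup>1\<close>. Hence \<open>F(\<tau>)\<^sup>n\<close> and \<open>R(\<tau>)\<^sup>n\<close> differ by \<open>O(1/n)\<close>, uniformly in \<open>\<tau>\<close>.

  It remains to compare \<open>R(\<tau>)\<^sup>n\<close> with \<open>exp (- n \<tau> H)\<close>. For \<open>P = R(2 \<sigma>)\<close> and \<open>Q = R(\<sigma>)\<^sup>2\<close> the
  operator \<open>D\<close> is \<open>R(\<sigma>/2) / 4\<close>, so that halving the step changes \<open>R(\<tau>)\<^sup>n\<close> by at most \<open>20/n\<close>, the
  next halving by at most \<open>20/(2n)\<close>, and so on. The powers therefore converge in norm along the
  dyadic refinements of a grid of step \<open>\<theta>\<close>, and the limit at a grid point \<open>n \<theta>\<close> is within \<open>42/n\<close> of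
  \<open>R(\<theta>)\<^sup>n\<close> (\<open>grid.resolvent_power_rate\<close>). The limit is a strongly continuous semigroup with
  generator \<open>- H\<close> (\<open>grid.C0_semigroup_grid\<close>, \<open>grid.generator_grid\<close>). Such a semigroup is unique
  (\<open>C0_semigroup_unique\<close>), so the limit does not depend on \<open>\<theta>\<close>, and the choice \<open>\<theta> = t/n\<close> makes any
  given \<open>t\<close> a grid point.
\<close>

section \<open>Positive contractions and their powers\<close>

text \<open>
  Symmetry and positivity refer to the real inner product, the real part of \<open>cinner\<close>. For
  complex-linear operators they are the usual notions.
\<close>

definition symmetric_op :: "('a::real_inner \<Rightarrow>\<^sub>L 'a) \<Rightarrow> bool" where
  "symmetric_op A \<longleftrightarrow> (\<forall>x y. A x \<bullet> y = x \<bullet> A y)"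

definition positive_op :: "('a::real_inner \<Rightarrow>\<^sub>L 'a) \<Rightarrow> bool" where
  "positive_op A \<longleftrightarrow> symmetric_op A \<and> (\<forall>x. 0 \<le> x \<bullet> A x)"

definition positive_contraction :: "('a::real_inner \<Rightarrow>\<^sub>L 'a) \<Rightarrow> bool" where
  "positive_contraction P \<longleftrightarrow> positive_op P \<and> positive_op (id_blinfun - P)"

lemma symmetric_opD: "symmetric_op A \<Longrightarrow> A x \<bullet> y = x \<bullet> A y"
  by (simp add: symmetric_op_def)

lemma positive_contraction_symmetric: "positive_contraction P \<Longrightarrow> symmetric_op P"
  by (simp add: positive_contraction_def positive_op_def)

lemma positive_contraction_alt:
  "positive_contraction P \<longleftrightarrow>
     symmetric_op P \<and> (\<forall>x. 0 \<le> x \<bullet> P x \<and> x \<bullet> P x \<le> x \<bullet> x)"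
  by (auto simp: positive_contraction_def positive_op_def symmetric_op_def
      blinfun.bilinear_simps inner_diff_left inner_diff_right)

lemma positive_contraction_complement:
  "positive_contraction P \<Longrightarrow> positive_contraction (id_blinfun - P)"
  by (simp add: positive_contraction_def)

text \<open>
  The identity \<open>P - P\<^sup>2 = P (1 - P) P + (1 - P) P (1 - P)\<close> writes \<open>P - P\<^sup>2\<close> as a sum of positive
  operators.
\<close>

lemma positive_contraction_square_le:
  assumes P: "positive_contraction P"
  shows "P x \<bullet> P x \<le> x \<bullet> P x"
proof -
  have "P x \<bullet> P (P x) \<le> P x \<bullet> P x" "0 \<le> (x - P x) \<bullet> P (x - P x)"
    using P by (auto simp: positive_contraction_alt)
  moreover have "(x - P x) \<bullet> P (x - P x) = x \<bullet> P x - 2 * (P x \<bullet> P x) + P x \<bullet> P (P x)"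
    using positive_contraction_symmetric[OF P]
    by (simp add: symmetric_op_def blinfun.bilinear_simps algebra_simps inner_diff_left inner_diff_right)
  ultimately show ?thesis by linarith
qed

lemma positive_contraction_norm_le:
  assumes P: "positive_contraction P"
  shows "norm (P x) \<le> norm x"
proof -
  have "P x \<bullet> P x \<le> x \<bullet> x"
    using P by (intro order.trans[OF positive_contraction_square_le[OF P]])
      (simp add: positive_contraction_alt)
  then show ?thesis by (simp add: norm_le)
qed

lemma norm_positive_contraction: "positive_contraction P \<Longrightarrow> norm P \<le> 1"
  by (rule norm_blinfun_bound) (auto simp: positive_contraction_norm_le)

lemma norm_le_of_form_le:
  assumes A: "positive_op A" and c: "0 < c" and le: "\<And>x. x \<bullet> A x \<le> c * (x \<bullet> x)"
  shows "norm A \<le> c"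
proof -
  have "positive_contraction ((1/c) *\<^sub>R A)"
    using A c le by (auto simp: positive_contraction_alt positive_op_def symmetric_op_def
      blinfun.bilinear_simps field_simps)
  from norm_positive_contraction[OF this] show ?thesis using c by (simp add: field_simps)
qed

lemma norm_le_of_adjoint:
  fixes X Y :: "'a::real_inner \<Rightarrow>\<^sub>L 'a"
  assumes adj: "\<And>x y. X x \<bullet> y = x \<bullet> Y y"
  shows "norm X \<le> norm Y"
proof (rule norm_blinfun_bound)
  fix x
  have "norm (X x) * norm (X x) = x \<bullet> Y (X x)"
    by (metis adj power2_norm_eq_inner power2_eq_square)
  also have "\<dots> \<le> norm x * (norm Y * norm (X x))"
    by (intro order.trans[OF norm_cauchy_schwarz] mult_left_mono norm_blinfun norm_ge_zero)
  finally show "norm (X x) \<le> norm Y * norm x"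
    by (cases "X x = 0") (auto simp: algebra_simps)
qed simp

lemma blinfun_compose_id [simp]: "id_blinfun o\<^sub>L A = A" "A o\<^sub>L id_blinfun = A"
  by (auto intro: blinfun_eqI)

lemma op_power_0 [simp]: "op_power A 0 = id_blinfun"
  by (simp add: op_power_def)

lemma op_power_Suc [simp]: "op_power A (Suc n) = A o\<^sub>L op_power A n"
  by (simp add: op_power_def)

lemma op_power_add_apply: "op_power A (m + n) x = op_power A m (op_power A n x)"
  by (induction m) auto

lemma op_power_commute_apply:
  fixes A B :: "'a::complex_hilbert \<Rightarrow>\<^sub>L 'a"
  shows "(\<And>x. A (B x) = B (A x)) \<Longrightarrow> op_power A n (B x) = B (op_power A n x)"
  by (induction n) auto

lemma op_power_shift: "op_power A n (A x) = A (op_power A n x)"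
  by (rule op_power_commute_apply) simp

lemma op_power_mult: "op_power (op_power A m) n = op_power A (m * n)"
  by (rule blinfun_eqI, induction n) (auto simp: op_power_add_apply)

lemma norm_op_power_le: "norm A \<le> 1 \<Longrightarrow> norm (op_power A n) \<le> 1"
proof (induction n)
  case (Suc n)
  have "norm (A o\<^sub>L op_power A n) \<le> norm A * norm (op_power A n)" by (rule norm_blinfun_compose)
  also have "\<dots> \<le> 1" using Suc by (simp add: mult_le_one)
  finally show ?case by simp
qed (simp add: norm_blinfun_id_le)

lemma symmetric_op_power: "symmetric_op A \<Longrightarrow> symmetric_op (op_power A n)"
  by (induction n) (auto simp: symmetric_op_def op_power_shift)

lemma positive_op_power:
  assumes A: "positive_op A"
  shows "positive_op (op_power A n)"
proof -
  have sym: "symmetric_op A" using A by (simp add: positive_op_def)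
  have "0 \<le> x \<bullet> op_power A n x" for x
  proof (induction n arbitrary: x rule: induct_nat_012)
    case (ge2 n)
    have "x \<bullet> op_power A (Suc (Suc n)) x = A x \<bullet> op_power A n (A x)"
      using sym by (simp add: symmetric_op_def op_power_shift)
    then show ?case using ge2 by simp
  qed (use A in \<open>auto simp: positive_op_def\<close>)
  then show ?thesis using symmetric_op_power[OF sym] by (simp add: positive_op_def)
qed

lemma positive_contraction_power:
  assumes P: "positive_contraction P"
  shows "positive_contraction (op_power P n)"
proof -
  have "x \<bullet> op_power P n x \<le> x \<bullet> x" for x
  proof -
    have "norm (op_power P n) \<le> 1"
      by (rule norm_op_power_le[OF norm_positive_contraction[OF P]])
    then have "norm (op_power P n x) \<le> norm x"
      by (metis mult_left_le_one_le norm_blinfun norm_ge_zero order_trans)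
    then have "x \<bullet> op_power P n x \<le> norm x * norm x"
      by (intro order.trans[OF norm_cauchy_schwarz] mult_left_mono) auto
    then show ?thesis by (simp add: power2_norm_eq_inner[symmetric] power2_eq_square)
  qed
  then show ?thesis
    using positive_op_power[of P n] P by (auto simp: positive_contraction_alt positive_op_def)
qed

text \<open>
  The forms \<open>a\<^sub>j = \<langle>x, P\<^sup>j (1 - P) x\<rangle>\<close> are nonnegative, decrease in \<open>j\<close>, and their sum over \<open>j \<le> k\<close>
  telescopes to at most \<open>\<langle>x, x\<rangle>\<close>; so the last of them is at most \<open>\<langle>x, x\<rangle> / (k + 1)\<close>. This is the
  smoothing estimate \<open>\<parallel>A exp (- t A)\<parallel> \<le> C / t\<close> in discrete time.
\<close>

lemma norm_power_complement_le:
  assumes P: "positive_contraction P"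
  shows "norm (op_power P k o\<^sub>L (id_blinfun - P)) \<le> 1 / (real k + 1)"
proof (rule norm_le_of_form_le)
  define a where "a j x = x \<bullet> op_power P j x - x \<bullet> op_power P (Suc j) x" for j x
  have sym: "symmetric_op P" by (rule positive_contraction_symmetric[OF P])
  have X: "x \<bullet> (op_power P k o\<^sub>L (id_blinfun - P)) x = a k x" for x
    by (simp add: a_def blinfun.bilinear_simps inner_diff_right op_power_shift)
  have a_pos: "0 \<le> a j x" for j x
  proof (induction j arbitrary: x rule: induct_nat_012)
    case 0 then show ?case using P by (simp add: a_def positive_contraction_alt)
  next
    case 1 then show ?case
      using positive_contraction_square_le[OF P, of x] symmetric_opD[OF sym, of x "P x"]
      by (simp add: a_def)
  next
    case (ge2 j)
    have "a (Suc (Suc j)) x = a j (P x)"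
      using sym by (simp add: a_def symmetric_op_def op_power_shift)
    then show ?case using ge2 by simp
  qed
  \<comment> \<open>the difference is the form of \<open>P\<^sup>j\<close> at \<open>(1 - P) x\<close>\<close>
  have a_mono: "a (Suc j) x \<le> a j x" for j x
  proof -
    have "0 \<le> (x - P x) \<bullet> op_power P j (x - P x)"
      using positive_op_power[of P j] P by (simp add: positive_contraction_def positive_op_def)
    also have "\<dots> = a j x - a (Suc j) x"
      using sym by (simp add: a_def symmetric_op_def blinfun.bilinear_simps inner_diff_left
          inner_diff_right op_power_shift)
    finally show ?thesis by simp
  qed
  have a_anti: "j \<le> k \<Longrightarrow> a k x \<le> a j x" for j x
    by (rule lift_Suc_antimono_le[of "\<lambda>j. a j x"]) (auto intro: a_mono)
  show "x \<bullet> (op_power P k o\<^sub>L (id_blinfun - P)) x \<le> 1 / (real k + 1) * (x \<bullet> x)" for x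
  proof -
    have "(real k + 1) * a k x = (\<Sum>j<Suc k. a k x)" by simp
    also have "\<dots> \<le> (\<Sum>j<Suc k. a j x)" by (intro sum_mono a_anti) auto
    also have "\<dots> = x \<bullet> x - x \<bullet> op_power P (Suc k) x"
      unfolding a_def by (subst sum_lessThan_telescope') simp
    also have "\<dots> \<le> x \<bullet> x"
      using positive_op_power[of P "Suc k"] P by (simp add: positive_contraction_def positive_op_def)
    finally show ?thesis unfolding X by (simp add: field_simps)
  qed
  show "positive_op (op_power P k o\<^sub>L (id_blinfun - P))"
    using X a_pos symmetric_op_power[OF sym, of k] sym
    by (auto simp: positive_op_def symmetric_op_def blinfun.bilinear_simps inner_diff_left
        inner_diff_right op_power_shift)
qed simp

lemma norm_power_complement_square_le:
  assumes P: "positive_contraction P"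
  shows "norm (op_power P k o\<^sub>L (id_blinfun - P) o\<^sub>L (id_blinfun - P)) \<le> 4 / (real k + 1)\<^sup>2"
proof -
  define i j where "i = k div 2" and "j = k - k div 2"
  have ij: "k = i + j" "real k + 1 \<le> 2 * (real i + 1)" "real k + 1 \<le> 2 * (real j + 1)"
    by (auto simp: i_def j_def)
  have "op_power P k o\<^sub>L (id_blinfun - P) o\<^sub>L (id_blinfun - P)
      = (op_power P i o\<^sub>L (id_blinfun - P)) o\<^sub>L (op_power P j o\<^sub>L (id_blinfun - P))"
    by (rule blinfun_eqI)
      (simp add: ij(1) op_power_add_apply blinfun.bilinear_simps op_power_shift)
  also have "norm \<dots> \<le> (1 / (real i + 1)) * (1 / (real j + 1))"
    by (intro order.trans[OF norm_blinfun_compose] mult_mono norm_power_complement_le P) auto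
  also have "\<dots> \<le> (2 / (real k + 1)) * (2 / (real k + 1))"
    by (intro mult_mono) (use ij in \<open>auto simp: field_simps\<close>)
  finally show ?thesis by (simp add: power2_eq_square)
qed

section \<open>Comparing powers of two positive contractions\<close>

text \<open>
  Telescoping \<open>P\<^sup>m Q\<^sup>j - Q\<^sup>m\<^sup>+\<^sup>j\<close> directly gives terms \<open>P\<^sup>i (1 - P) D (1 - Q) Q\<^sup>l\<close> of size \<open>1 / (i l)\<close>,
  whose sum over \<open>i\<close> is too large by a logarithm. Adding the correction \<open>P\<^sup>m D (1 - Q) Q\<^sup>l\<close> is a
  summation by parts: it removes the factor \<open>1 - P\<close> and puts a second factor \<open>1 - Q\<close> on the side
  where the power stays high, so that each of the \<open>m\<close> steps costs only \<open>O(1 / l\<^sup>2)\<close>. The bound on \<open>m\<close>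
  ensures that \<open>l\<close> is comparable with \<open>m + l\<close>.
\<close>

lemma power_minus_power_half:
  assumes P: "positive_contraction P" and Q: "positive_contraction Q"
    and PQ: "P - Q = (id_blinfun - P) o\<^sub>L D o\<^sub>L (id_blinfun - Q)"
    and m: "m \<le> 2 * Suc l"
  shows "norm ((op_power P m o\<^sub>L op_power Q (Suc l)) - op_power Q (m + Suc l))
           \<le> 40 * norm D / real (m + Suc l)"
proof -
  define G where "G l = D o\<^sub>L (id_blinfun - Q) o\<^sub>L op_power Q l" for l
  have PQx: "P x = Q x + D (x - Q x) - P (D (x - Q x))" for x
    using arg_cong[OF PQ, of "\<lambda>A. blinfun_apply A x"] by (simp add: blinfun.bilinear_simps algebra_simps)
  have normP: "norm (op_power P i) \<le> 1" for i
    by (rule norm_op_power_le[OF norm_positive_contraction[OF P]])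
  have comm: "(id_blinfun - Q) o\<^sub>L op_power Q i = op_power Q i o\<^sub>L (id_blinfun - Q)" for i
    by (rule blinfun_eqI) (simp add: blinfun.bilinear_simps op_power_shift)
  have "G i = D o\<^sub>L (op_power Q i o\<^sub>L (id_blinfun - Q))" for i
    unfolding comm[symmetric] by (rule blinfun_eqI) (simp add: G_def)
  then have G: "norm (G i) \<le> norm D * (1 / (real i + 1))" for i
    by (simp only:)
 (intro order.trans[OF norm_blinfun_compose] mult_left_mono norm_power_complement_le Q norm_ge_zero)
  have PG: "norm (op_power P i o\<^sub>L G j) \<le> norm D * (1 / (real j + 1))" for i j
    using order.trans[OF norm_blinfun_compose mult_mono[OF normP G]] by simp
  have tele: "norm (((op_power P m o\<^sub>L op_power Q (Suc l)) + (op_power P m o\<^sub>L G l))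
       - (op_power Q (m + Suc l) + G (m + l))) \<le> real m * (norm D * (4 / (real l + 1)\<^sup>2))" for m l
  proof (induction m arbitrary: l)
    case 0
    then show ?case by simp
  next
    case (Suc m)
    let ?N = "op_power P (Suc m) o\<^sub>L (D o\<^sub>L (op_power Q l o\<^sub>L (id_blinfun - Q) o\<^sub>L (id_blinfun - Q)))"
    have "norm ?N \<le> 1 * (norm D * (4 / (real l + 1)\<^sup>2))"
      by (rule order.trans[OF norm_blinfun_compose], rule mult_mono, rule normP,
          rule order.trans[OF norm_blinfun_compose], rule mult_left_mono,
          rule norm_power_complement_square_le[OF Q]) auto
    moreover have "((op_power P (Suc m) o\<^sub>L op_power Q (Suc l)) + (op_power P (Suc m) o\<^sub>L G l))
       - (op_power Q (Suc m + Suc l) + G (Suc m + l))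
      = (((op_power P m o\<^sub>L op_power Q (Suc (Suc l))) + (op_power P m o\<^sub>L G (Suc l)))
       - (op_power Q (m + Suc (Suc l)) + G (m + Suc l))) + ?N"
    proof (rule blinfun_eqI)
      fix x
      show "(((op_power P (Suc m) o\<^sub>L op_power Q (Suc l)) + (op_power P (Suc m) o\<^sub>L G l))
         - (op_power Q (Suc m + Suc l) + G (Suc m + l))) x
        = ((((op_power P m o\<^sub>L op_power Q (Suc (Suc l))) + (op_power P m o\<^sub>L G (Suc l)))
         - (op_power Q (m + Suc (Suc l)) + G (m + Suc l))) + ?N) x"
        using arg_cong[OF PQx[of "Q (op_power Q l x)"], of "op_power P m"]
        by (simp add: G_def blinfun.bilinear_simps op_power_shift)
    qed
    ultimately have "norm (((op_power P (Suc m) o\<^sub>L op_power Q (Suc l)) + (op_power P (Suc m) o\<^sub>L G l))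
        - (op_power Q (Suc m + Suc l) + G (Suc m + l)))
      \<le> real m * (norm D * (4 / (real (Suc l) + 1)\<^sup>2)) + 1 * (norm D * (4 / (real l + 1)\<^sup>2))"
      using norm_triangle_mono[OF Suc.IH[of "Suc l"]] by metis
    also have "\<dots> \<le> real m * (norm D * (4 / (real l + 1)\<^sup>2)) + 1 * (norm D * (4 / (real l + 1)\<^sup>2))"
      by (intro add_mono mult_left_mono order.refl divide_left_mono power_mono) auto
    also have "\<dots> = real (Suc m) * (norm D * (4 / (real l + 1)\<^sup>2))"
      by (simp only: of_nat_Suc distrib_right add.commute)
    finally show ?case .
  qed
  define n where "n = m + Suc l"
  have n: "0 < real n" "real m \<le> real n" "real n \<le> 3 * (real l + 1)"
    using m by (auto simp: n_def)
  have "norm ((op_power P m o\<^sub>L op_power Q (Suc l)) - op_power Q (m + Suc l))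
     \<le> norm (((op_power P m o\<^sub>L op_power Q (Suc l)) + (op_power P m o\<^sub>L G l))
       - (op_power Q (m + Suc l) + G (m + l))) + norm (op_power P m o\<^sub>L G l) + norm (G (m + l))"
    by norm
  also have "\<dots> \<le> real m * (norm D * (4 / (real l + 1)\<^sup>2)) + norm D * (1 / (real l + 1))
      + norm D * (1 / (real (m + l) + 1))"
    by (intro add_mono tele PG G)
  also have "\<dots> = norm D * (4 * real m / (real l + 1)\<^sup>2 + 1 / (real l + 1) + 1 / real n)"
    by (simp add: n_def algebra_simps)
  also have "\<dots> \<le> norm D * (36 / real n + 3 / real n + 1 / real n)"
  proof (intro mult_left_mono add_mono)
    show "1 / (real l + 1) \<le> 3 / real n" using n by (simp add: field_simps)
    have "real m * (real n)\<^sup>2 \<le> real n * (3 * (real l + 1))\<^sup>2"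
      by (intro mult_mono power_mono) (use n in auto)
    then have "real m * real n \<le> (3 * (real l + 1))\<^sup>2"
      using n(1) by (simp add: power2_eq_square)
    then have "4 * real m * real n \<le> 36 * (real l + 1)\<^sup>2"
      unfolding power_mult_distrib by simp
    moreover have "0 < (real l + 1)\<^sup>2" by simp
    ultimately show "4 * real m / (real l + 1)\<^sup>2 \<le> 36 / real n"
      using n(1) by (simp only: pos_divide_le_eq pos_le_divide_eq times_divide_eq_left)
  qed auto
  also have "\<dots> = 40 * norm D / real n" using n(1) by (simp add: field_simps)
  finally show ?thesis unfolding n_def .
qed

text \<open>
  Go from \<open>P\<^sup>n\<close> to \<open>Q\<^sup>n\<close> through \<open>P\<^sup>m Q\<^sup>l\<close> with \<open>m\<close> and \<open>l\<close> both about \<open>n/2\<close>. The second half is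
  \<open>power_minus_power_half\<close>; the first half is its adjoint with \<open>P\<close> and \<open>Q\<close> exchanged, which is why
  \<open>D\<close> is assumed symmetric.
\<close>

theorem norm_power_minus_power_le:
  assumes P: "positive_contraction P" and Q: "positive_contraction Q"
    and PQ: "P - Q = (id_blinfun - P) o\<^sub>L D o\<^sub>L (id_blinfun - Q)"
    and D: "symmetric_op D" and n: "n \<ge> 1"
  shows "norm (op_power P n - op_power Q n) \<le> 80 * norm D / real n"
proof (cases "n = 1")
  case True
  have "norm (P - Q) \<le> norm (id_blinfun - P) * norm D * norm (id_blinfun - Q)"
    unfolding PQ by (intro order.trans[OF norm_blinfun_compose] mult_right_mono norm_blinfun_compose norm_ge_zero)
  also have "\<dots> \<le> 1 * norm D * 1"
    by (intro mult_mono norm_positive_contraction positive_contraction_complement P Q) auto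
  finally have "norm (P - Q) \<le> norm D" by simp
  moreover have "op_power P n - op_power Q n = P - Q"
    using True by (auto intro: blinfun_eqI simp: blinfun.bilinear_simps)
  moreover have "norm D \<le> 80 * norm D / real n" using True by simp
  ultimately show ?thesis by (metis order.trans)
next
  case False
  define m l where "m = n div 2 - 1" and "l = n - n div 2 - 1"
  have ml: "n = Suc m + Suc l" "Suc m \<le> 2 * Suc l" "Suc l \<le> 2 * Suc m"
    using n False by (auto simp: m_def l_def)
  have sym: "symmetric_op P" "symmetric_op Q"
    using P Q by (auto intro: positive_contraction_symmetric)
  \<comment> \<open>the adjoint of the hypothesis, since all operators in it are symmetric\<close>
  have QP: "Q - P = (id_blinfun - Q) o\<^sub>L (- D) o\<^sub>L (id_blinfun - P)"
  proof (rule blinfun_eqI)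
    fix x
    have "((Q - P) x) \<bullet> y = (((id_blinfun - Q) o\<^sub>L (- D) o\<^sub>L (id_blinfun - P)) x) \<bullet> y" for y
    proof -
      have "((Q - P) x) \<bullet> y = - (x \<bullet> (P - Q) y)"
        using sym by (simp add: symmetric_op_def blinfun.bilinear_simps inner_diff_left inner_diff_right)
      also have "\<dots> = (((id_blinfun - Q) o\<^sub>L (- D) o\<^sub>L (id_blinfun - P)) x) \<bullet> y"
        unfolding PQ using sym D
        by (simp add: symmetric_op_def blinfun.bilinear_simps inner_diff_left inner_diff_right)
      finally show ?thesis .
    qed
    then show "(Q - P) x = ((id_blinfun - Q) o\<^sub>L (- D) o\<^sub>L (id_blinfun - P)) x"
      by (metis vector_eq_rdot)
  qed
  have "norm ((op_power P (Suc m) o\<^sub>L op_power Q (Suc l)) - op_power P n)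
     \<le> norm ((op_power Q (Suc l) o\<^sub>L op_power P (Suc m)) - op_power P n)"
    by (rule norm_le_of_adjoint)
      (simp only: blinfun.bilinear_simps blinfun_apply_blinfun_compose inner_diff_left inner_diff_right
        symmetric_opD[OF symmetric_op_power[OF sym(1)]] symmetric_opD[OF symmetric_op_power[OF sym(2)]])
  also have "\<dots> \<le> 40 * norm D / real n"
    using power_minus_power_half[OF Q P QP ml(3)] ml(1) by (simp only: norm_minus_cancel add.commute)
  finally have 1: "norm ((op_power P (Suc m) o\<^sub>L op_power Q (Suc l)) - op_power P n) \<le> 40 * norm D / real n" .
  have 2: "norm ((op_power P (Suc m) o\<^sub>L op_power Q (Suc l)) - op_power Q n) \<le> 40 * norm D / real n"
    using power_minus_power_half[OF P Q PQ ml(2)] ml(1) by simp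
  have "norm (op_power P n - op_power Q n) \<le> 40 * norm D / real n + 40 * norm D / real n"
    using norm_triangle_le_diff[OF add_mono[OF 2 1]] by simp
  then show ?thesis by simp
qed

section \<open>Resolvents through the inverse operator\<close>

instance complex_hilbert \<subseteq> banach ..

text \<open>
  The inverse of \<open>1 - X\<close> at \<open>y\<close> is the fixed point of the contraction \<open>x \<mapsto> y + X x\<close>.
\<close>

lemma neumann_inverse:
  fixes X :: "'a::banach \<Rightarrow>\<^sub>L 'a"
  assumes X: "norm X < 1"
  obtains Y :: "'a \<Rightarrow>\<^sub>L 'a" where "\<And>x. Y (x - X x) = x" "\<And>x. Y x - X (Y x) = x"
    "norm Y \<le> 1 / (1 - norm X)"
proof -
  have ex1: "\<exists>!x. y + X x = x" for y
  proof (rule banach_fix_type[of "norm X"], safe)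
    fix a b
    show "dist (y + X a) (y + X b) \<le> norm X * dist a b"
      using norm_blinfun[of X "a - b"] by (simp add: dist_norm blinfun.diff_right)
  qed (use X in auto)
  define g where "g y = (THE x. y + X x = x)" for y
  have g: "y + X (g y) = g y" for y
    unfolding g_def by (rule theI'[OF ex1])
  have g_unique: "y + X x = x \<Longrightarrow> g y = x" for x y
    using ex1 g by blast
  have g_norm: "norm (g y) \<le> norm y * (1 / (1 - norm X))" for y
  proof -
    have "norm (g y) \<le> norm y + norm X * norm (g y)"
      using norm_triangle_ineq[of y "X (g y)"] norm_blinfun[of X "g y"] by (simp add: g)
    then show ?thesis using X by (simp add: field_simps)
  qed
  have lin: "bounded_linear g"
  proof (rule bounded_linear_intro)
    show "g (x + y) = g x + g y" for x y
      using arg_cong2[OF g[of x] g[of y], of "(+)"]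
      by (intro g_unique) (simp add: blinfun.add_right ac_simps)
    show "g (r *\<^sub>R x) = r *\<^sub>R g x" for r x
      using g[of x] by (intro g_unique) (metis blinfun.scaleR_right scaleR_right_distrib)
  qed (rule g_norm)
  show ?thesis
  proof
    show "Blinfun g (x - X x) = x" for x
      using lin by (simp add: bounded_linear_Blinfun_apply g_unique)
    show "Blinfun g x - X (Blinfun g x) = x" for x
      using g[of x] lin by (simp add: bounded_linear_Blinfun_apply algebra_simps)
    show "norm (Blinfun g) \<le> 1 / (1 - norm X)"
      using g_norm lin X
      by (intro norm_blinfun_bound) (simp_all add: bounded_linear_Blinfun_apply mult.commute)
  qed
qed

definition shifted_inverse :: "('a::real_normed_vector \<Rightarrow>\<^sub>L 'a) \<Rightarrow> real \<Rightarrow> ('a \<Rightarrow>\<^sub>L 'a)" where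
  "shifted_inverse K \<tau> =
     (SOME V. \<forall>x. blinfun_apply V (K x + \<tau> *\<^sub>R x) = x \<and> K (V x) + \<tau> *\<^sub>R V x = x)"

lemma shifted_inverse:
  fixes K :: "'a::complex_hilbert \<Rightarrow>\<^sub>L 'a"
  assumes K: "positive_op K" and \<tau>: "0 < \<tau>"
  shows "shifted_inverse K \<tau> (K x + \<tau> *\<^sub>R x) = x"
    and "K (shifted_inverse K \<tau> x) + \<tau> *\<^sub>R shifted_inverse K \<tau> x = x"
proof -
  \<comment> \<open>\<open>c\<close> exceeds both \<open>\<parallel>K + \<tau>\<parallel>\<close> and \<open>\<tau>\<close>, so \<open>1 - (K + \<tau>) / c\<close> is positive with norm below \<open>1\<close>\<close>
  define c where "c = \<tau> + norm K + 1"
  define X where "X = id_blinfun - (1/c) *\<^sub>R (K + \<tau> *\<^sub>R id_blinfun)"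
  have c: "0 < c" "\<tau> < c" unfolding c_def using \<tau> norm_ge_zero[of K] by linarith+
  have KK: "x \<bullet> K x \<le> norm K * (x \<bullet> x)" for x
    using order.trans[OF norm_cauchy_schwarz mult_left_mono[OF norm_blinfun norm_ge_zero], of x K x]
    by (simp add: power2_norm_eq_inner[symmetric] power2_eq_square algebra_simps)
  have X_form: "x \<bullet> X x = x \<bullet> x - (x \<bullet> K x + \<tau> * (x \<bullet> x)) / c" for x
    by (simp add: X_def blinfun.bilinear_simps inner_diff_right inner_add_right algebra_simps
        add_divide_distrib)
  have "norm X \<le> 1 - \<tau> / c"
  proof (rule norm_le_of_form_le)
    show "0 < 1 - \<tau> / c" using c by simp
    show "x \<bullet> X x \<le> (1 - \<tau> / c) * (x \<bullet> x)" for x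
      using K c unfolding X_form positive_op_def by (simp add: field_simps)
    have "x \<bullet> K x + \<tau> * (x \<bullet> x) \<le> c * (x \<bullet> x)" for x
      using KK[of x] inner_ge_zero[of x] unfolding c_def distrib_right by linarith
    then have "0 \<le> x \<bullet> X x" for x
      unfolding X_form using c by (simp add: field_simps)
    then show "positive_op X"
      using K by (simp add: positive_op_def symmetric_op_def X_def blinfun.bilinear_simps
          inner_diff_left inner_diff_right inner_add_left inner_add_right)
  qed
  moreover have "1 - \<tau> / c < 1" using c \<tau> by simp
  ultimately have "norm X < 1" by linarith
  then obtain Y :: "'a \<Rightarrow>\<^sub>L 'a" where Y: "\<And>x. Y (x - X x) = x" "\<And>x. Y x - X (Y x) = x"
    by (rule neumann_inverse) blast
  have X: "x - X x = (1/c) *\<^sub>R (K x + \<tau> *\<^sub>R x)" for x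
    by (simp add: X_def blinfun.bilinear_simps)
  have "\<forall>x. ((1/c) *\<^sub>R Y) (K x + \<tau> *\<^sub>R x) = x
          \<and> K (((1/c) *\<^sub>R Y) x) + \<tau> *\<^sub>R ((1/c) *\<^sub>R Y) x = x"
    using Y unfolding X by (simp add: blinfun.bilinear_simps scaleR_add_right mult.commute)
  then have "\<forall>x. shifted_inverse K \<tau> (K x + \<tau> *\<^sub>R x) = x
     \<and> K (shifted_inverse K \<tau> x) + \<tau> *\<^sub>R shifted_inverse K \<tau> x = x"
    unfolding shifted_inverse_def by (rule someI)
  then show "shifted_inverse K \<tau> (K x + \<tau> *\<^sub>R x) = x"
    and "K (shifted_inverse K \<tau> x) + \<tau> *\<^sub>R shifted_inverse K \<tau> x = x"
    by blast+
qed

text \<open>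
  If \<open>K\<close> is the inverse of \<open>H\<close>, this is \<open>(1 + \<tau> H)\<^sup>-\<^sup>1 = K (K + \<tau>)\<^sup>-\<^sup>1 = 1 - \<tau> (K + \<tau>)\<^sup>-\<^sup>1\<close>. The
  last form involves bounded operators only.
\<close>

definition resolvent :: "('a::real_normed_vector \<Rightarrow>\<^sub>L 'a) \<Rightarrow> real \<Rightarrow> ('a \<Rightarrow>\<^sub>L 'a)" where
  "resolvent K \<tau> = id_blinfun - \<tau> *\<^sub>R shifted_inverse K \<tau>"

context
  fixes K :: "'a::complex_hilbert \<Rightarrow>\<^sub>L 'a"
  assumes K: "positive_op K"
begin

text \<open>
  Every vector has the form \<open>K w + \<tau> w\<close>. Identities between resolvents become identities between
  polynomials in \<open>K\<close> once the argument is written in this way.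
\<close>

lemma resolvent_apply:
  assumes "0 < \<tau>" shows "resolvent K \<tau> (K x + \<tau> *\<^sub>R x) = K x"
  using shifted_inverse(1)[OF K assms]
  by (simp add: resolvent_def blinfun.diff_left blinfun.scaleR_left)

lemma shifted_surj:
  assumes "0 < \<tau>" obtains w where "x = K w + \<tau> *\<^sub>R w"
  using shifted_inverse(2)[OF K assms] by metis

lemma positive_contraction_resolvent:
  assumes \<tau>: "0 < \<tau>"
  shows "positive_contraction (resolvent K \<tau>)"
  unfolding positive_contraction_alt symmetric_op_def
proof (intro conjI allI)
  have Kx: "K x \<bullet> y = x \<bullet> K y" "0 \<le> x \<bullet> K x" for x y
    using K by (auto simp: positive_op_def symmetric_op_def)
  fix x y
  obtain v where v: "x = K v + \<tau> *\<^sub>R v" using \<tau> by (rule shifted_surj)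
  obtain w where w: "y = K w + \<tau> *\<^sub>R w" using \<tau> by (rule shifted_surj)
  have R: "resolvent K \<tau> x = K v" "resolvent K \<tau> y = K w"
    unfolding v w using \<tau> by (simp_all only: resolvent_apply)
  show "resolvent K \<tau> x \<bullet> y = x \<bullet> resolvent K \<tau> y"
    unfolding R unfolding v w by (simp add: inner_add_left inner_add_right Kx)
  show "0 \<le> x \<bullet> resolvent K \<tau> x"
    unfolding R unfolding v using Kx(2)[of v] \<tau> by (simp add: inner_add_left)
  have "x \<bullet> x - x \<bullet> resolvent K \<tau> x = \<tau> * (v \<bullet> K v) + \<tau> * \<tau> * (v \<bullet> v)"
    unfolding R unfolding v by (simp add: inner_add_left inner_add_right Kx algebra_simps)
  then show "x \<bullet> resolvent K \<tau> x \<le> x \<bullet> x"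
    using Kx(2)[of v] \<tau> by (smt (verit) inner_ge_zero mult_nonneg_nonneg)
qed

lemma resolvent_commute:
  assumes \<tau>: "0 < \<tau>" shows "resolvent K \<tau> (K x) = K (resolvent K \<tau> x)"
proof -
  obtain w where w: "x = K w + \<tau> *\<^sub>R w" using \<tau> by (rule shifted_surj)
  have "K x = K (K w) + \<tau> *\<^sub>R K w" unfolding w by (simp add: blinfun.bilinear_simps)
  then show ?thesis using resolvent_apply[OF \<tau>] w by metis
qed

text \<open>
  This is \<open>(1 - R) H\<^sup>-\<^sup>1 = \<tau> R\<close> for \<open>R = (1 + \<tau> H)\<^sup>-\<^sup>1\<close>: one implicit Euler step.
\<close>

lemma resolvent_step:
  assumes \<tau>: "0 < \<tau>" shows "K x - resolvent K \<tau> (K x) = \<tau> *\<^sub>R resolvent K \<tau> x"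
proof -
  obtain w where w: "x = K w + \<tau> *\<^sub>R w" using \<tau> by (rule shifted_surj)
  have "resolvent K \<tau> x = K w" unfolding w by (rule resolvent_apply[OF \<tau>])
  then show ?thesis
    unfolding resolvent_commute[OF \<tau>] by (simp add: w blinfun.bilinear_simps)
qed

lemma norm_resolvent_power_apply_le:
  assumes "0 < \<tau>" shows "norm (op_power (resolvent K \<tau>) m x) \<le> norm x"
  by (intro positive_contraction_norm_le positive_contraction_power positive_contraction_resolvent assms)

text \<open>
  With a number \<open>\<kappa>\<close> in place of \<open>K\<close>, the middle factor \<open>\<kappa> / (4 \<kappa> + 2 \<sigma>)\<close> is the difference of
  \<open>1 / (1 - P) = (\<kappa> + 2 \<sigma>) / (2 \<sigma>)\<close> and \<open>1 / (1 - Q) = (\<kappa> + \<sigma>)\<^sup>2 / (2 \<kappa> \<sigma> + \<sigma>\<^sup>2)\<close>.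
\<close>

lemma resolvent_halving:
  assumes \<sigma>: "0 < \<sigma>"
  defines "P \<equiv> resolvent K (2 * \<sigma>)" and "Q \<equiv> op_power (resolvent K \<sigma>) 2"
  shows "P - Q = (id_blinfun - P) o\<^sub>L ((1/4) *\<^sub>R resolvent K (\<sigma> / 2)) o\<^sub>L (id_blinfun - Q)"
proof (rule blinfun_eqI)
  fix x
  have \<sigma>2: "0 < 2 * \<sigma>" "0 < \<sigma> / 2" using \<sigma> by auto
  obtain w1 where w1: "x = K w1 + \<sigma> *\<^sub>R w1" using \<sigma> by (rule shifted_surj)
  obtain w2 where w2: "w1 = K w2 + \<sigma> *\<^sub>R w2" using \<sigma> by (rule shifted_surj)
  obtain w3 where w3: "w2 = K w3 + (2 * \<sigma>) *\<^sub>R w3" using \<sigma>2(1) by (rule shifted_surj)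
  have x: "x = K (K w2) + (2 * \<sigma>) *\<^sub>R K w2 + (\<sigma> * \<sigma>) *\<^sub>R w2"
    unfolding w1 w2 by (simp add: blinfun.bilinear_simps algebra_simps scaleR_add_left[symmetric])
  have "resolvent K \<sigma> x = K w1" "resolvent K \<sigma> w1 = K w2"
    using resolvent_apply[OF \<sigma>] w1 w2 by metis+
  then have Qx: "Q x = K (K w2)"
    by (simp add: Q_def numeral_2_eq_2 resolvent_commute[OF \<sigma>])
  have Pw2: "P w2 = K w3" unfolding P_def using resolvent_apply[OF \<sigma>2(1)] w3 by metis
  have PK: "P (K y) = K (P y)" for y unfolding P_def by (rule resolvent_commute[OF \<sigma>2(1)])
  have "(id_blinfun - Q) x = (2 * \<sigma>) *\<^sub>R (K w2 + (\<sigma> / 2) *\<^sub>R w2)"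
    unfolding blinfun.diff_left Qx by (simp add: x algebra_simps)
  then have D: "((1/4) *\<^sub>R resolvent K (\<sigma> / 2)) ((id_blinfun - Q) x) = (\<sigma> / 2) *\<^sub>R K w2"
    by (simp add: blinfun.scaleR_left blinfun.scaleR_right resolvent_apply[OF \<sigma>2(2)])
  have "w2 - P w2 = (2 * \<sigma>) *\<^sub>R w3" unfolding Pw2 using w3 by simp
  then have "((id_blinfun - P) o\<^sub>L ((1/4) *\<^sub>R resolvent K (\<sigma> / 2)) o\<^sub>L (id_blinfun - Q)) x
      = (\<sigma> / 2) *\<^sub>R K ((2 * \<sigma>) *\<^sub>R w3)"
    unfolding blinfun_apply_blinfun_compose D
    by (simp add: blinfun.diff_left blinfun.diff_right blinfun.scaleR_right scaleR_diff_right PK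
        flip: \<open>w2 - P w2 = (2 * \<sigma>) *\<^sub>R w3\<close>)
  also have "\<dots> = (\<sigma> * \<sigma>) *\<^sub>R K w3" by (simp add: blinfun.bilinear_simps)
  also have "\<dots> = (P - Q) x"
    unfolding blinfun.diff_left Qx unfolding x
    by (simp add: blinfun.add_right blinfun.scaleR_right PK Pw2)
      (simp add: w3 blinfun.bilinear_simps algebra_simps)
  finally show "(P - Q) x = ((id_blinfun - P) o\<^sub>L ((1/4) *\<^sub>R resolvent K (\<sigma> / 2)) o\<^sub>L (id_blinfun - Q)) x"
    by simp
qed

lemma resolvent_power_halving:
  assumes \<sigma>: "0 < \<sigma>" and n: "n \<ge> 1"
  shows "norm (op_power (resolvent K (2 * \<sigma>)) n - op_power (resolvent K \<sigma>) (2 * n)) \<le> 20 / real n"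
proof -
  let ?D = "(1/4) *\<^sub>R resolvent K (\<sigma> / 2)"
  have R: "positive_contraction (resolvent K a)" if "0 < a" for a
    by (rule positive_contraction_resolvent[OF that])
  have "symmetric_op ?D"
    using positive_contraction_symmetric[OF R[of "\<sigma> / 2"]] \<sigma>
    by (simp add: symmetric_op_def blinfun.scaleR_left)
  moreover have "positive_contraction (op_power (resolvent K \<sigma>) 2)"
    by (rule positive_contraction_power[OF R[OF \<sigma>]])
  ultimately have "norm (op_power (resolvent K (2 * \<sigma>)) n - op_power (op_power (resolvent K \<sigma>) 2) n)
      \<le> 80 * norm ?D / real n"
    using norm_power_minus_power_le[OF _ _ resolvent_halving[OF \<sigma>] _ n] R[of "2 * \<sigma>"] \<sigma> by simp
  also have "\<dots> \<le> 20 / real n"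
    using norm_positive_contraction[OF R[of "\<sigma> / 2"]] \<sigma> by (intro divide_right_mono) auto
  finally show ?thesis by (simp add: op_power_mult)
qed

text \<open>
  On the range of \<open>K\<close>, the domain of \<open>H\<close>, each step moves \<open>K z\<close> by at most \<open>\<tau> \<parallel>z\<parallel>\<close>. The term with
  \<open>x - K z\<close> extends this to all \<open>x\<close> by density, uniformly in the step \<open>\<tau>\<close>.
\<close>

lemma resolvent_power_drift:
  assumes \<tau>: "0 < \<tau>"
  shows "norm (op_power (resolvent K \<tau>) m x - x) \<le> real m * \<tau> * norm z + 2 * norm (x - K z)"
proof -
  let ?R = "resolvent K \<tau>"
  have range: "norm (op_power ?R m (K z) - K z) \<le> real m * (\<tau> * norm z)"
  proof (induction m)
    case (Suc m)
    have "norm (?R (op_power ?R m (K z) - K z)) \<le> norm (op_power ?R m (K z) - K z)"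
      by (rule positive_contraction_norm_le[OF positive_contraction_resolvent[OF \<tau>]])
    then have 1: "norm (?R (op_power ?R m (K z) - K z)) \<le> real m * (\<tau> * norm z)"
      using Suc by linarith
    have "norm (\<tau> *\<^sub>R ?R z) \<le> \<tau> * norm z"
      using \<tau> positive_contraction_norm_le[OF positive_contraction_resolvent[OF \<tau>]] by simp
    then have 2: "norm (K z - ?R (K z)) \<le> \<tau> * norm z"
      by (simp only: resolvent_step[OF \<tau>])
    have "op_power ?R (Suc m) (K z) - K z = ?R (op_power ?R m (K z) - K z) - (K z - ?R (K z))"
      by (simp add: blinfun.diff_right)
    then have "norm (op_power ?R (Suc m) (K z) - K z) \<le> real m * (\<tau> * norm z) + \<tau> * norm z"
      using norm_triangle_le_diff[OF add_mono[OF 1 2]] by metis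
    then show ?case by (simp add: algebra_simps)
  qed simp
  have "op_power ?R m x - x = (op_power ?R m (K z) - K z) + (op_power ?R m (x - K z) - (x - K z))"
    by (simp add: blinfun.diff_right)
  also have "norm \<dots> \<le> real m * (\<tau> * norm z) + (norm (op_power ?R m (x - K z)) + norm (x - K z))"
    by (intro norm_triangle_mono range norm_triangle_ineq4)
  also have "\<dots> \<le> real m * (\<tau> * norm z) + (norm (x - K z) + norm (x - K z))"
    by (intro add_mono order.refl norm_resolvent_power_apply_le[OF \<tau>])
  finally show ?thesis by simp
qed

text \<open>
  The \<open>m\<close> steps change \<open>K y\<close> by \<open>- \<tau> (R y + \<dots> + R\<^sup>m y)\<close>, and each \<open>R\<^sup>j y\<close> is close to \<open>y\<close> by
  \<open>resolvent_power_drift\<close>. In the limit this identifies the generator.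
\<close>

lemma resolvent_power_derivative:
  assumes \<tau>: "0 < \<tau>" and h: "real m * \<tau> \<le> h"
  shows "norm (op_power (resolvent K \<tau>) m (K y) - K y + (real m * \<tau>) *\<^sub>R y)
           \<le> real m * \<tau> * (h * norm z + 2 * norm (y - K z))"
  using h
proof (induction m)
  case (Suc m)
  let ?R = "resolvent K \<tau>" and ?c = "h * norm z + 2 * norm (y - K z)"
  have "real m * \<tau> \<le> real (Suc m) * \<tau>" using \<tau> by (intro mult_right_mono) auto
  then have 1: "norm (op_power ?R m (K y) - K y + (real m * \<tau>) *\<^sub>R y) \<le> real m * \<tau> * ?c"
    using Suc.prems by (intro Suc.IH) linarith
  have "norm (op_power ?R (Suc m) y - y) \<le> real (Suc m) * \<tau> * norm z + 2 * norm (y - K z)"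
    by (rule resolvent_power_drift[OF \<tau>])
  also have "\<dots> \<le> ?c"
    using Suc.prems by (intro add_mono mult_right_mono order.refl norm_ge_zero)
  finally have 2: "norm (- \<tau> *\<^sub>R (op_power ?R (Suc m) y - y)) \<le> \<tau> * ?c"
    using \<tau> by simp
  have "op_power ?R m (K y) - op_power ?R (Suc m) (K y) = \<tau> *\<^sub>R op_power ?R (Suc m) y"
    using arg_cong[OF resolvent_step[OF \<tau>, of y], of "op_power ?R m"]
    by (simp add: blinfun.diff_right blinfun.scaleR_right op_power_shift)
  then have "op_power ?R (Suc m) (K y) - K y + (real (Suc m) * \<tau>) *\<^sub>R y
      = (op_power ?R m (K y) - K y + (real m * \<tau>) *\<^sub>R y) + (- \<tau> *\<^sub>R (op_power ?R (Suc m) y - y))"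
    by (simp add: algebra_simps)
  then have "norm (op_power ?R (Suc m) (K y) - K y + (real (Suc m) * \<tau>) *\<^sub>R y)
      \<le> real m * \<tau> * ?c + \<tau> * ?c"
    using norm_triangle_mono[OF 1 2] by metis
  also have "\<dots> = real (Suc m) * \<tau> * ?c" by (simp add: algebra_simps)
  finally show ?case .
qed simp

end

section \<open>Construction of the semigroup\<close>

lemma limit_of_geometric_steps:
  fixes X :: "nat \<Rightarrow> 'b::banach"
  assumes step: "\<And>k. norm (X (Suc k) - X k) \<le> c / 2 ^ k"
  shows "convergent X" and "norm (X 0 - lim X) \<le> 2 * c"
proof -
  have "(\<lambda>k. c * (1/2) ^ k) sums (c * (1 / (1 - 1/2)))"
    by (intro sums_mult geometric_sums) simp
  then have S: "(\<lambda>k. c / 2 ^ k) sums (2 * c)"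
    by (simp add: power_divide mult.commute[of _ c])
  have ns: "summable (\<lambda>k. norm (X (Suc k) - X k))"
    by (rule summable_comparison_test'[OF sums_summable[OF S]]) (use step in simp)
  have "(\<lambda>n. \<Sum>k<n. X (Suc k) - X k) \<longlonglongrightarrow> (\<Sum>k. X (Suc k) - X k)"
    by (rule summable_LIMSEQ[OF summable_norm_cancel[OF ns]])
  then have "(\<lambda>n. (X n - X 0) + X 0) \<longlonglongrightarrow> (\<Sum>k. X (Suc k) - X k) + X 0"
    by (intro tendsto_add) (simp_all add: sum_lessThan_telescope)
  then have L: "X \<longlonglongrightarrow> (\<Sum>k. X (Suc k) - X k) + X 0" by simp
  then show "convergent X" by (rule convergentI)
  have "norm (\<Sum>k. X (Suc k) - X k) \<le> (\<Sum>k. norm (X (Suc k) - X k))"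
    by (rule summable_norm[OF ns])
  also have "\<dots> \<le> (\<Sum>k. c / 2 ^ k)"
    by (intro suminf_le step ns sums_summable[OF S])
  also have "\<dots> = 2 * c" using S by (simp add: sums_iff)
  finally show "norm (X 0 - lim X) \<le> 2 * c"
    using limI[OF L] by simp
qed

text \<open>
  Continuity of the multiplication by complex scalars, needed to pass complex linearity to limits.
\<close>

lemma norm_scaleC: "norm (c *\<^sub>C x) = cmod c * norm x"
proof -
  have "cinner (c *\<^sub>C x) (c *\<^sub>C x) = c * cnj (c * cinner x x)"
    by (metis cinner_commute cinner_scaleC_right)
  also have "\<dots> = complex_of_real ((cmod c)\<^sup>2) * cnj (cinner x x)"
    by (simp add: complex_norm_square[symmetric])
  finally have "inner (c *\<^sub>C x) (c *\<^sub>C x) = (cmod c)\<^sup>2 * inner x x"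
    by (simp add: inner_eq_Re_cinner)
  then show ?thesis
    by (simp add: norm_eq_sqrt_inner real_sqrt_mult)
qed

lemma scaleC_scaleR: "c *\<^sub>C (r *\<^sub>R x) = r *\<^sub>R (c *\<^sub>C x)"
  by (simp add: scaleR_scaleC scaleC_scaleC mult.commute)

lemma bounded_linear_scaleC: "bounded_linear (\<lambda>x. c *\<^sub>C x)"
  by (rule bounded_linear_intro[of _ "cmod c"])
    (simp_all add: scaleC_add_right scaleC_scaleR norm_scaleC mult.commute)

lemma bounded_operators_limit:
  assumes "\<And>k. A k \<in> bounded_operators" and "A \<longlonglongrightarrow> B"
  shows "B \<in> bounded_operators"
proof -
  have "B (c *\<^sub>C x) = c *\<^sub>C B x" for c x
  proof (rule LIMSEQ_unique)
    show "(\<lambda>k. A k (c *\<^sub>C x)) \<longlonglongrightarrow> B (c *\<^sub>C x)"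
      by (intro tendsto_intros assms(2))
    show "(\<lambda>k. A k (c *\<^sub>C x)) \<longlonglongrightarrow> c *\<^sub>C B x"
      using assms(1) bounded_linear.tendsto[OF bounded_linear_scaleC blinfun.tendsto[OF assms(2) tendsto_const]]
      by (simp add: bounded_operators_def)
  qed
  then show ?thesis by (simp add: bounded_operators_def)
qed

lemma op_power_bounded_operators: "A \<in> bounded_operators \<Longrightarrow> op_power A n \<in> bounded_operators"
  by (induction n) (auto simp: bounded_operators_def)

lemma norm_power_diff_Suc:
  assumes P: "positive_contraction P"
  shows "norm (op_power P n - op_power P (Suc n)) \<le> 1 / (real n + 1)"
proof -
  have "op_power P n - op_power P (Suc n) = op_power P n o\<^sub>L (id_blinfun - P)"
    by (rule blinfun_eqI) (simp add: blinfun.diff_left blinfun.diff_right op_power_shift)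
  then show ?thesis using norm_power_complement_le[OF P, of n] by simp
qed

text \<open>
  Refining the grid, or adding two times, changes the number of grid steps by at most one beyond
  the expected number. That extra factor is harmless by \<open>norm_power_diff_Suc\<close>.
\<close>

lemma nat_floor_double:
  fixes x :: real
  assumes "0 \<le> x"
  shows "nat \<lfloor>2 * x\<rfloor> = 2 * nat \<lfloor>x\<rfloor> \<or> nat \<lfloor>2 * x\<rfloor> = Suc (2 * nat \<lfloor>x\<rfloor>)"
proof -
  have "0 \<le> \<lfloor>x\<rfloor>" "\<lfloor>2 * x\<rfloor> = 2 * \<lfloor>x\<rfloor> \<or> \<lfloor>2 * x\<rfloor> = 2 * \<lfloor>x\<rfloor> + 1" using assms by linarith+
  then show ?thesis by linarith
qed

lemma nat_floor_add:
  fixes x y :: real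
  assumes "0 \<le> x" "0 \<le> y"
  shows "nat \<lfloor>x + y\<rfloor> = nat \<lfloor>x\<rfloor> + nat \<lfloor>y\<rfloor> \<or> nat \<lfloor>x + y\<rfloor> = Suc (nat \<lfloor>x\<rfloor> + nat \<lfloor>y\<rfloor>)"
proof -
  have "0 \<le> \<lfloor>x\<rfloor>" "0 \<le> \<lfloor>y\<rfloor>" "\<lfloor>x + y\<rfloor> = \<lfloor>x\<rfloor> + \<lfloor>y\<rfloor> \<or> \<lfloor>x + y\<rfloor> = \<lfloor>x\<rfloor> + \<lfloor>y\<rfloor> + 1"
    using assms by linarith+
  then show ?thesis by linarith
qed

lemma real_nat_floor:
  fixes x :: real
  assumes "0 \<le> x"
  shows "real (nat \<lfloor>x\<rfloor>) \<le> x" and "x < real (nat \<lfloor>x\<rfloor>) + 1"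
  using assms by linarith+

text \<open>
  The \<open>k\<close>-th approximation follows the implicit Euler scheme with step \<open>\<theta> / 2\<^sup>k\<close> up to the last grid
  point not beyond \<open>t\<close>.
\<close>

definition grid_power :: "('a::complex_hilbert \<Rightarrow>\<^sub>L 'a) \<Rightarrow> real \<Rightarrow> real \<Rightarrow> nat \<Rightarrow> ('a \<Rightarrow>\<^sub>L 'a)" where
  "grid_power K \<theta> t k = op_power (resolvent K (\<theta> / 2 ^ k)) (nat \<lfloor>t / (\<theta> / 2 ^ k)\<rfloor>)"

definition grid_semigroup :: "('a::complex_hilbert \<Rightarrow>\<^sub>L 'a) \<Rightarrow> real \<Rightarrow> real \<Rightarrow> ('a \<Rightarrow>\<^sub>L 'a)" where
  "grid_semigroup K \<theta> t = lim (grid_power K \<theta> t)"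

text \<open>
  \<open>K\<close> stands for the inverse of \<open>H\<close>; its range is the domain of \<open>H\<close>.
\<close>

locale grid =
  fixes K :: "'a::complex_hilbert \<Rightarrow>\<^sub>L 'a" and \<theta> :: real
  assumes K: "positive_op K" and K_complex: "K \<in> bounded_operators"
    and K_dense: "closure (range (blinfun_apply K)) = UNIV"
    and \<theta>: "0 < \<theta>"
begin

definition step :: "nat \<Rightarrow> real" where "step k = \<theta> / 2 ^ k"

definition count :: "real \<Rightarrow> nat \<Rightarrow> nat" where "count t k = nat \<lfloor>t / step k\<rfloor>"

lemma grid_power_eq: "grid_power K \<theta> t k = op_power (resolvent K (step k)) (count t k)"
  by (simp add: grid_power_def step_def count_def)

lemma step_0: "step 0 = \<theta>" by (simp add: step_def)

lemma step_pos: "0 < step k" using \<theta> by (simp add: step_def)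

lemma step_double: "2 * step (Suc k) = step k" by (simp add: step_def)

lemma step_tendsto_0: "step \<longlonglongrightarrow> 0"
  using tendsto_mult_right_zero[OF LIMSEQ_realpow_zero[of "1/2::real"], of \<theta>]
  by (simp add: step_def[abs_def] power_divide)

lemma grid_nonneg: "0 \<le> t \<Longrightarrow> 0 \<le> t / step k"
  using step_pos[of k] by (intro divide_nonneg_pos)

lemma count_step:
  assumes "0 \<le> t"
  shows "real (count t k) * step k \<le> t" and "t < (real (count t k) + 1) * step k"
  using real_nat_floor[OF grid_nonneg[OF assms], of k] step_pos[of k] unfolding count_def
  by (simp_all only: pos_divide_less_eq pos_le_divide_eq)

lemma count_Suc:
  assumes "0 \<le> t"
  shows "count t (Suc k) = 2 * count t k \<or> count t (Suc k) = Suc (2 * count t k)"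
proof -
  have "t / step (Suc k) = 2 * (t / step k)" by (simp add: step_def)
  then show ?thesis using nat_floor_double[OF grid_nonneg[OF assms], of k] by (simp only: count_def)
qed

lemma count_ge: "0 \<le> t \<Longrightarrow> 2 ^ k * count t 0 \<le> count t k"
proof (induction k)
  case (Suc k)
  then show ?case using count_Suc[of t k] by auto
qed simp

lemma R: "positive_contraction (resolvent K (step k))"
  by (rule positive_contraction_resolvent[OF K step_pos])

lemma grid_power_step:
  assumes t: "0 \<le> t" and n: "1 \<le> count t 0"
  shows "norm (grid_power K \<theta> t (Suc k) - grid_power K \<theta> t k) \<le> (21 / real (count t 0)) / 2 ^ k"
proof -
  let ?r = "resolvent K (step (Suc k))" and ?N = "count t k"
  have "(1::nat) \<le> 2 ^ k * count t 0" using n by simp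
  then have N: "1 \<le> ?N" using count_ge[OF t] order.trans by blast
  have "norm (grid_power K \<theta> t k - op_power ?r (2 * ?N)) \<le> 20 / real ?N"
    using resolvent_power_halving[OF K step_pos N, of "Suc k"] by (simp only: step_double grid_power_eq)
  moreover have "norm (op_power ?r (2 * ?N) - grid_power K \<theta> t (Suc k)) \<le> 1 / real ?N"
  proof (cases "count t (Suc k) = 2 * ?N")
    case True
    then show ?thesis by (simp add: grid_power_eq)
  next
    case False
    then have "count t (Suc k) = Suc (2 * ?N)" using count_Suc[OF t] by blast
    then have "norm (op_power ?r (2 * ?N) - grid_power K \<theta> t (Suc k)) \<le> 1 / (real (2 * ?N) + 1)"
      using norm_power_diff_Suc[OF R] unfolding grid_power_eq by metis
    also have "\<dots> \<le> 1 / real ?N" using N by (intro frac_le) auto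
    finally show ?thesis .
  qed
  ultimately have "norm (grid_power K \<theta> t k - grid_power K \<theta> t (Suc k)) \<le> 20 / real ?N + 1 / real ?N"
    using norm_triangle_mono[of "grid_power K \<theta> t k - op_power ?r (2 * ?N)" "20 / real ?N"
      "op_power ?r (2 * ?N) - grid_power K \<theta> t (Suc k)" "1 / real ?N"] by simp
  also have "\<dots> = 21 / real ?N" by simp
  also have "\<dots> \<le> 21 / (2 ^ k * real (count t 0))"
  proof (intro frac_le)
    have "real (2 ^ k * count t 0) \<le> real ?N" using count_ge[OF t] of_nat_le_iff by blast
    then show "2 ^ k * real (count t 0) \<le> real ?N" by simp
  qed (use n in auto)
  also have "\<dots> = (21 / real (count t 0)) / 2 ^ k" by (simp add: mult.commute)
  finally show ?thesis by (simp only: norm_minus_commute)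
qed

text \<open>
  Starting from \<open>n\<close> steps, the \<open>k\<close>-th halving changes the power by at most \<open>21 / (2\<^sup>k n)\<close>: \<open>20\<close> from
  the halving itself and \<open>1\<close> from a possible additional step.
\<close>

lemma grid_power_rate:
  assumes t: "0 \<le> t" and n: "1 \<le> count t 0"
  shows "convergent (grid_power K \<theta> t)"
    and "norm (grid_power K \<theta> t 0 - grid_semigroup K \<theta> t) \<le> 42 / real (count t 0)"
  using limit_of_geometric_steps[of "grid_power K \<theta> t", OF grid_power_step[OF t n]]
  by (simp_all add: grid_semigroup_def)

text \<open>
  A time below \<open>\<theta>\<close> has no grid step at first, and the rate says nothing. It has one on a fine enough
  grid, whose approximations are the tail of the given ones.
\<close>

lemma grid_power_tendsto:
  assumes t: "0 \<le> t" shows "grid_power K \<theta> t \<longlonglongrightarrow> grid_semigroup K \<theta> t"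
proof -
  have "convergent (grid_power K \<theta> t)"
  proof (cases "t = 0")
    case True
    then have "grid_power K \<theta> t = (\<lambda>k. id_blinfun)" by (auto simp: grid_power_def)
    then show ?thesis by (simp add: convergent_const)
  next
    case False
    then have "0 < t" using t by simp
    then have "\<forall>\<^sub>F j in sequentially. step j < t" by (rule order_tendstoD(2)[OF step_tendsto_0])
    then obtain j where j: "step j < t" by (auto simp: eventually_sequentially)
    interpret fine: grid K "step j"
      by unfold_locales (use K K_complex K_dense step_pos in auto)
    have "1 < t / step j" using j step_pos[of j] by (simp only: pos_less_divide_eq mult_1_left)
    then have "1 \<le> \<lfloor>t / step j\<rfloor>" by (simp only: le_floor_iff of_int_1 less_imp_le)
    then have "1 \<le> fine.count t 0" by (simp add: fine.count_def fine.step_def le_nat_iff)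
    then have "convergent (grid_power K (step j) t)"
      by (rule fine.grid_power_rate(1)[OF t])
    moreover have "grid_power K (step j) t = (\<lambda>k. grid_power K \<theta> t (k + j))"
      by (rule ext) (simp add: grid_power_def step_def power_add mult.commute)
    ultimately show ?thesis by (simp add: convergent_ignore_initial_segment)
  qed
  then show ?thesis unfolding grid_semigroup_def by (simp add: convergent_LIMSEQ_iff)
qed

lemma grid_power_apply_tendsto:
  assumes "0 \<le> t" shows "(\<lambda>k. grid_power K \<theta> t k x) \<longlonglongrightarrow> grid_semigroup K \<theta> t x"
  by (intro tendsto_intros grid_power_tendsto assms)

lemma resolvent_power_rate:
  assumes n: "1 \<le> n"
  shows "norm (op_power (resolvent K \<theta>) n - grid_semigroup K \<theta> (real n * \<theta>)) \<le> 42 / real n"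
  using grid_power_rate(2)[of "real n * \<theta>"] n \<theta> by (simp add: grid_power_eq count_def step_0)

lemma grid_semigroup_0: "grid_semigroup K \<theta> 0 = id_blinfun"
proof -
  have "grid_power K \<theta> 0 = (\<lambda>k. id_blinfun)" by (auto simp: grid_power_def)
  then show ?thesis by (simp add: grid_semigroup_def)
qed

text \<open>
  The approximations are powers of a single operator, so they satisfy the semigroup law up to one
  factor \<open>R\<close>. Replacing \<open>R\<^sup>m\<close> by \<open>R\<^sup>m\<^sup>+\<^sup>1\<close> costs \<open>1 / (m + 1)\<close>, which vanishes as the grid is refined.
\<close>

lemma grid_semigroup_add:
  assumes s: "0 \<le> s" and t: "0 \<le> t"
  shows "grid_semigroup K \<theta> (s + t) = grid_semigroup K \<theta> s o\<^sub>L grid_semigroup K \<theta> t"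
proof (cases "s = 0")
  case True
  then show ?thesis by (simp add: grid_semigroup_0)
next
  case False
  have bound: "norm ((grid_power K \<theta> s k o\<^sub>L grid_power K \<theta> t k) - grid_power K \<theta> (s + t) k) \<le> step k / s" for k
  proof -
    let ?r = "resolvent K (step k)" and ?m = "count s k + count t k"
    have "grid_power K \<theta> s k o\<^sub>L grid_power K \<theta> t k = op_power ?r ?m"
      by (rule blinfun_eqI) (simp add: grid_power_eq op_power_add_apply)
    moreover have "norm (op_power ?r ?m - grid_power K \<theta> (s + t) k) \<le> 1 / (real ?m + 1)"
    proof (cases "count (s + t) k = ?m")
      case True
      then show ?thesis by (simp add: grid_power_eq)
    next
      case False
      then have "count (s + t) k = Suc ?m"
        using nat_floor_add[OF grid_nonneg[OF s] grid_nonneg[OF t], of k k]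
        by (simp add: count_def add_divide_distrib)
      then show ?thesis
        using norm_power_diff_Suc[OF R] unfolding grid_power_eq by metis
    qed
    moreover have "1 / (real ?m + 1) \<le> step k / s"
    proof -
      have "s \<le> (real (count s k) + 1) * step k" using count_step(2)[OF s, of k] by simp
      also have "\<dots> \<le> (real ?m + 1) * step k" using step_pos[of k] by (intro mult_right_mono) auto
      finally show ?thesis
        using s \<open>s \<noteq> 0\<close> by (simp add: field_simps)
    qed
    ultimately show ?thesis by simp
  qed
  have "(\<lambda>k. step k / s) \<longlonglongrightarrow> 0"
    using tendsto_divide[OF step_tendsto_0 tendsto_const[of s]] False by simp
  then have "(\<lambda>k. (grid_power K \<theta> s k o\<^sub>L grid_power K \<theta> t k) - grid_power K \<theta> (s + t) k) \<longlonglongrightarrow> 0"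
    by (rule Lim_null_comparison[rotated]) (use bound in simp)
  moreover have "(\<lambda>k. (grid_power K \<theta> s k o\<^sub>L grid_power K \<theta> t k) - grid_power K \<theta> (s + t) k)
     \<longlonglongrightarrow> (grid_semigroup K \<theta> s o\<^sub>L grid_semigroup K \<theta> t) - grid_semigroup K \<theta> (s + t)"
    using s t by (intro tendsto_intros grid_power_tendsto
      bounded_bilinear.tendsto[OF bounded_bilinear_blinfun_compose]) auto
  ultimately show ?thesis using LIMSEQ_unique by fastforce
qed

lemma resolvent_bounded_operators:
  assumes \<tau>: "0 < \<tau>" shows "resolvent K \<tau> \<in> bounded_operators"
proof -
  have Kc: "K (c *\<^sub>C x) = c *\<^sub>C K x" for c x using K_complex by (simp add: bounded_operators_def)
  have "resolvent K \<tau> (c *\<^sub>C x) = c *\<^sub>C resolvent K \<tau> x" for c x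
  proof -
    obtain w where w: "x = K w + \<tau> *\<^sub>R w" using K \<tau> by (rule shifted_surj)
    have "c *\<^sub>C x = K (c *\<^sub>C w) + \<tau> *\<^sub>R (c *\<^sub>C w)"
      unfolding w by (simp add: scaleC_add_right scaleC_scaleR Kc)
    then show ?thesis using resolvent_apply[OF K \<tau>] w Kc by metis
  qed
  then show ?thesis by (simp add: bounded_operators_def)
qed

lemma grid_semigroup_bounded_operators:
  assumes "0 \<le> t" shows "grid_semigroup K \<theta> t \<in> bounded_operators"
  using grid_power_tendsto[OF assms]
  by (rule bounded_operators_limit[rotated])
    (simp add: grid_power_eq op_power_bounded_operators resolvent_bounded_operators step_pos)

lemma grid_semigroup_commute:
  assumes t: "0 \<le> t" shows "grid_semigroup K \<theta> t (K x) = K (grid_semigroup K \<theta> t x)"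
proof (rule LIMSEQ_unique)
  show "(\<lambda>k. grid_power K \<theta> t k (K x)) \<longlonglongrightarrow> grid_semigroup K \<theta> t (K x)"
    by (rule grid_power_apply_tendsto[OF t])
  have "(\<lambda>k. K (grid_power K \<theta> t k x)) \<longlonglongrightarrow> K (grid_semigroup K \<theta> t x)"
    by (intro tendsto_intros grid_power_apply_tendsto[OF t])
  moreover have "grid_power K \<theta> t k (K x) = K (grid_power K \<theta> t k x)" for k
    unfolding grid_power_eq by (rule op_power_commute_apply[OF resolvent_commute[OF K step_pos]])
  ultimately show "(\<lambda>k. grid_power K \<theta> t k (K x)) \<longlonglongrightarrow> K (grid_semigroup K \<theta> t x)" by simp
qed

lemma grid_semigroup_drift:
  assumes t: "0 \<le> t"
  shows "norm (grid_semigroup K \<theta> t x - x) \<le> t * norm z + 2 * norm (x - K z)"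
proof (rule LIMSEQ_le_const2)
  show "(\<lambda>k. norm (grid_power K \<theta> t k x - x)) \<longlonglongrightarrow> norm (grid_semigroup K \<theta> t x - x)"
    by (intro tendsto_intros grid_power_apply_tendsto[OF t])
  have "norm (grid_power K \<theta> t k x - x) \<le> t * norm z + 2 * norm (x - K z)" for k
    unfolding grid_power_eq
    by (intro order.trans[OF resolvent_power_drift[OF K step_pos, where z = z]] add_mono order.refl mult_right_mono norm_ge_zero)
      (rule count_step(1)[OF t])
  then show "\<exists>N. \<forall>k\<ge>N. norm (grid_power K \<theta> t k x - x) \<le> t * norm z + 2 * norm (x - K z)"
    by blast
qed

lemma grid_semigroup_derivative:
  assumes h: "0 \<le> h"
  shows "norm (grid_semigroup K \<theta> h (K y) - K y + h *\<^sub>R y) \<le> h * (h * norm z + 2 * norm (y - K z))"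
proof (rule LIMSEQ_le_const2)
  have "(\<lambda>k. h - step k) \<longlonglongrightarrow> h" using tendsto_diff[OF tendsto_const step_tendsto_0] by simp
  then have count_lim: "(\<lambda>k. real (count h k) * step k) \<longlonglongrightarrow> h"
    by (rule real_tendsto_sandwich[rotated 2, OF _ tendsto_const])
      (use count_step[OF h] in \<open>auto simp: distrib_right algebra_simps intro!: always_eventually less_imp_le\<close>)
  then show "(\<lambda>k. norm (grid_power K \<theta> h k (K y) - K y + (real (count h k) * step k) *\<^sub>R y))
      \<longlonglongrightarrow> norm (grid_semigroup K \<theta> h (K y) - K y + h *\<^sub>R y)"
    by (intro tendsto_intros grid_power_apply_tendsto[OF h])
  have "norm (grid_power K \<theta> h k (K y) - K y + (real (count h k) * step k) *\<^sub>R y)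
      \<le> h * (h * norm z + 2 * norm (y - K z))" for k
    unfolding grid_power_eq
    using count_step[OF h, of k] h
    by (intro order.trans[OF resolvent_power_derivative[OF K step_pos, where h = h and z = z]] mult_right_mono
        add_nonneg_nonneg mult_nonneg_nonneg) auto
  then show "\<exists>N. \<forall>k\<ge>N. norm (grid_power K \<theta> h k (K y) - K y + (real (count h k) * step k) *\<^sub>R y)
      \<le> h * (h * norm z + 2 * norm (y - K z))"
    by blast
qed

text \<open>
  Choose \<open>z\<close> first, using that the range of \<open>K\<close> is dense, and then \<open>h\<close>.
\<close>

lemma tendsto_of_approximation:
  fixes f :: "real \<Rightarrow> 'a"
  assumes f: "\<And>h z. 0 < h \<Longrightarrow> norm (f h - x) \<le> h * norm z + 2 * norm (y - K z)"
  shows "(f \<longlongrightarrow> x) (at_right 0)"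
proof (rule tendstoI)
  fix e :: real assume e: "0 < e"
  have "y \<in> closure (range (blinfun_apply K))" using K_dense by simp
  then obtain z where z: "norm (y - K z) < e / 4"
    using e by (auto simp: closure_approachable dist_norm norm_minus_commute
      dest!: spec[of _ "e / 4"])
  define d where "d = e / 2 / (norm z + 1)"
  have d: "0 < d" using e unfolding d_def by (intro divide_pos_pos) (auto intro: add_nonneg_pos)
  have nz: "norm z + 1 \<noteq> 0" using norm_ge_zero[of z] by linarith
  have "dist (f h) x < e" if h: "0 < h" "h < d" for h
  proof -
    have "h * norm z \<le> d * (norm z + 1)" using h by (intro mult_mono) auto
    also have "\<dots> = e / 2"
      unfolding d_def using nonzero_eq_divide_eq[OF nz] by blast
    finally have "h * norm z \<le> e / 2" .
    then have "norm (f h - x) < e" using f[OF h(1), of z] z by linarith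
    then show ?thesis by (simp only: dist_norm)
  qed
  then show "\<forall>\<^sub>F h in at_right 0. dist (f h) x < e"
    unfolding eventually_at_right_field using d by blast
qed

theorem C0_semigroup_grid: "C0_semigroup (grid_semigroup K \<theta>)"
  unfolding C0_semigroup_def strong_limit_def
  by (auto simp: grid_semigroup_bounded_operators grid_semigroup_0 grid_semigroup_add
      intro!: tendsto_of_approximation grid_semigroup_drift)

lemma generator_on_range:
  "((\<lambda>h. (grid_semigroup K \<theta> h (K y) - K y) /\<^sub>R h) \<longlongrightarrow> - y) (at_right 0)"
proof (rule tendsto_of_approximation[of _ _ y])
  fix h :: real and z assume h: "0 < h"
  have "(grid_semigroup K \<theta> h (K y) - K y) /\<^sub>R h - - y
      = (grid_semigroup K \<theta> h (K y) - K y + h *\<^sub>R y) /\<^sub>R h"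
    using h by (simp add: scaleR_add_right)
  also have "norm \<dots> \<le> (h * (h * norm z + 2 * norm (y - K z))) / h"
    using divide_right_mono[OF grid_semigroup_derivative[of h y z], of h] h
    by (simp add: divide_inverse mult.commute)
  finally show "norm ((grid_semigroup K \<theta> h (K y) - K y) /\<^sub>R h - - y) \<le> h * norm z + 2 * norm (y - K z)"
    using h by simp
qed

text \<open>
  That \<open>- H\<close> is contained in the generator is \<open>generator_on_range\<close>. Conversely, applying \<open>K\<close> to the
  difference quotient of \<open>x\<close> gives the difference quotient of \<open>K x\<close>, whose limit is \<open>- x\<close>; so \<open>x\<close> lies
  in the range of \<open>K\<close>.
\<close>

theorem generator_grid: "generator (grid_semigroup K \<theta>) = op_minus ((graph_of K)\<inverse>)"
proof (intro equalityI subsetI)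
  fix p assume "p \<in> op_minus ((graph_of K)\<inverse>)"
  then show "p \<in> generator (grid_semigroup K \<theta>)"
    using generator_on_range by (auto simp: op_minus_def graph_of_def generator_def)
next
  fix p assume "p \<in> generator (grid_semigroup K \<theta>)"
  then obtain x y where p: "p = (x, y)"
    and lim: "((\<lambda>h. (grid_semigroup K \<theta> h x - x) /\<^sub>R h) \<longlongrightarrow> y) (at_right 0)"
    by (auto simp: generator_def)
  have "((\<lambda>h. K ((grid_semigroup K \<theta> h x - x) /\<^sub>R h)) \<longlongrightarrow> K y) (at_right 0)"
    by (intro tendsto_intros lim)
  moreover have "\<forall>\<^sub>F h in at_right 0. K ((grid_semigroup K \<theta> h x - x) /\<^sub>R h)
       = (grid_semigroup K \<theta> h (K x) - K x) /\<^sub>R h"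
    by (auto simp: eventually_at_right_field grid_semigroup_commute blinfun.scaleR_right
        blinfun.diff_right intro!: exI[of _ 1])
  ultimately have "((\<lambda>h. (grid_semigroup K \<theta> h (K x) - K x) /\<^sub>R h) \<longlongrightarrow> K y) (at_right 0)"
    by (rule Lim_transform_eventually)
  then have "K y = - x"
    using generator_on_range tendsto_unique[OF trivial_limit_at_right_real] by blast
  then have "x = K (- y)" by (simp add: blinfun.minus_right)
  then show "p \<in> op_minus ((graph_of K)\<inverse>)"
    unfolding p op_minus_def graph_of_def by (auto intro!: exI[of _ "- y"])
qed

end

section \<open>Uniqueness of the semigroup with a given generator\<close>

text \<open>
  The Banach-Steinhaus theorem by the Baire category theorem.
\<close>

lemma uniform_boundedness:
  fixes A :: "nat \<Rightarrow> 'a::banach \<Rightarrow>\<^sub>L 'b::real_normed_vector"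
  assumes bounded: "\<And>x. bounded (range (\<lambda>n. A n x))"
  shows "bounded (range A)"
proof -
  define C where "C m = {x. \<forall>n. norm (A n x) \<le> real m}" for m
  have closed: "closed (C m)" for m
  proof -
    have "C m = (\<Inter>n. {x. norm (A n x) \<le> real m})" by (auto simp: C_def)
    moreover have "closed {x. norm (A n x) \<le> real m}" for n
      by (intro closed_Collect_le continuous_intros)
    ultimately show ?thesis by auto
  qed
  have union: "(\<Union>m. C m) = UNIV"
  proof (intro equalityI subsetI UNIV_I)
    fix x
    obtain b where "\<And>n. norm (A n x) \<le> b" using bounded[of x] by (auto simp: bounded_iff)
    moreover obtain m where "b \<le> real m" using real_arch_simple by blast
    ultimately have "x \<in> C m" unfolding C_def by (auto intro: order_trans)
    then show "x \<in> (\<Union>m. C m)" by blast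
  qed
  obtain m where m: "interior (C m) \<noteq> {}"
  proof (rule ccontr)
    assume "\<not> thesis"
    then have "interior (C m) = {}" for m using that by blast
    then have "Met_TC.mtopology interior_of (\<Union>(range C)) = {}"
      using closed complete_UNIV by (intro Met_TC.metric_Baire_category_alt) auto
    then show False using union by simp
  qed
  then obtain x where "x \<in> interior (C m)" by blast
  then obtain e where e: "0 < e" "cball x e \<subseteq> C m"
    by (meson mem_interior_cball)
  have "norm (A n) \<le> 2 * real m / e" for n
  proof (rule norm_blinfun_bound)
    show "0 \<le> 2 * real m / e" using e by simp
    fix y
    show "norm (A n y) \<le> 2 * real m / e * norm y"
    proof (cases "y = 0")
      case False
      define w where "w = (e / norm y) *\<^sub>R y"
      have "norm w = e" using False e by (simp add: w_def)
      then have "x \<in> C m" "x + w \<in> C m" using e by (auto simp: dist_norm)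
      then have "norm (A n (x + w)) \<le> real m" "norm (A n x) \<le> real m" by (auto simp: C_def)
      then have "norm (A n (x + w) - A n x) \<le> 2 * real m"
        using norm_triangle_ineq4[of "A n (x + w)" "A n x"] by linarith
      then have "(e / norm y) * norm (A n y) \<le> 2 * real m"
        using e by (simp add: w_def blinfun.bilinear_simps)
      then show ?thesis using False e by (simp add: field_simps)
    qed simp
  qed
  then show ?thesis unfolding bounded_iff by blast
qed

context
  fixes T :: "real \<Rightarrow> 'a::complex_hilbert \<Rightarrow>\<^sub>L 'a"
  assumes T: "C0_semigroup T"
begin

lemma semigroup_0: "T 0 = id_blinfun"
  using T by (simp add: C0_semigroup_def)

lemma semigroup_add: "0 \<le> s \<Longrightarrow> 0 \<le> t \<Longrightarrow> T (s + t) x = T s (T t x)"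
  using T by (simp add: C0_semigroup_def)

lemma semigroup_tendsto: "((\<lambda>h. T h x) \<longlongrightarrow> x) (at_right 0)"
  using T by (simp add: C0_semigroup_def strong_limit_def)

text \<open>
  Norms unbounded near \<open>0\<close> would be unbounded along a sequence of times tending to \<open>0\<close>. Along it every
  orbit converges, which contradicts uniform boundedness.
\<close>

lemma semigroup_locally_bounded: "\<exists>d>0. \<exists>M. \<forall>h\<in>{0..d}. norm (T h) \<le> M"
proof (rule ccontr)
  assume *: "\<not> ?thesis"
  have "\<exists>h. 0 \<le> h \<and> h \<le> inverse (real (Suc n)) \<and> real n + 1 < norm (T h)" for n
    using * by (meson atLeastAtMost_iff inverse_positive_iff_positive linorder_not_le of_nat_0_less_iff zero_less_Suc)
  then obtain h where h: "\<And>n. 0 \<le> h n" "\<And>n. h n \<le> inverse (real (Suc n))"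
    "\<And>n. real n + 1 < norm (T (h n))" by metis
  have nonzero: "h n \<noteq> 0" for n
  proof
    assume "h n = 0"
    then have "norm (T (h n)) \<le> 1" by (simp add: semigroup_0 norm_blinfun_id_le)
    then show False using h(3)[of n] by simp
  qed
  then have pos: "0 < h n" for n using h(1)[of n] by (metis order_less_le)
  have "h \<longlonglongrightarrow> 0"
    by (rule real_tendsto_sandwich[OF _ _ tendsto_const LIMSEQ_inverse_real_of_nat]) (use h in auto)
  then have "filterlim h (at_right 0) sequentially"
    using pos nonzero by (simp add: filterlim_at)
  then have "(\<lambda>n. T (h n) x) \<longlonglongrightarrow> x" for x
    by (rule filterlim_compose[OF semigroup_tendsto])
  then have "bounded (range (\<lambda>n. T (h n)))"
    by (intro uniform_boundedness convergent_imp_bounded)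
  then obtain b where b: "norm (T (h n)) \<le> b" for n by (auto simp: bounded_iff)
  obtain n where "b \<le> real n" using real_arch_simple by blast
  then show False using h(3)[of n] b[of n] by linarith
qed

lemma semigroup_bounded_on: "\<exists>M\<ge>1. \<forall>s\<in>{0..t}. norm (T s) \<le> M"
proof -
  obtain d M where d: "0 < d" and M: "\<And>h. 0 \<le> h \<Longrightarrow> h \<le> d \<Longrightarrow> norm (T h) \<le> M"
    using semigroup_locally_bounded by (metis atLeastAtMost_iff)
  define L where "L = max 1 M"
  have L: "1 \<le> L" "M \<le> L" by (auto simp: L_def)
  have grow: "norm (T s) \<le> L ^ Suc n" if "0 \<le> s" "s \<le> real n * d" for n s
    using that
  proof (induction n arbitrary: s)
    case 0
    then show ?case using M[of s] L d by simp
  next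
    case (Suc n)
    show ?case
    proof (cases "s \<le> d")
      case True
      have "norm (T s) \<le> L" using M[of s] Suc.prems True L by linarith
      also have "\<dots> \<le> L ^ Suc (Suc n)" using power_increasing[of 1 "Suc (Suc n)" L] L by simp
      finally show ?thesis .
    next
      case False
      have "T s = T d o\<^sub>L T (s - d)"
        using semigroup_add[of d "s - d"] d False by (intro blinfun_eqI) simp
      then have "norm (T s) \<le> norm (T d) * norm (T (s - d))" by (simp add: norm_blinfun_compose)
      also have "\<dots> \<le> L * L ^ Suc n"
      proof (intro mult_mono)
        show "norm (T d) \<le> L" using M[of d] d L by linarith
        show "norm (T (s - d)) \<le> L ^ Suc n"
          using Suc.prems False by (intro Suc.IH) (auto simp: algebra_simps)
      qed (use L in auto)
      finally show ?thesis by simp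
    qed
  qed
  obtain n where "t / d \<le> real n" using real_arch_simple by blast
  then have "t \<le> real n * d" using d by (simp add: pos_divide_le_eq)
  then have "\<forall>s\<in>{0..t}. norm (T s) \<le> L ^ Suc n" by (intro ballI grow) auto
  moreover have "1 \<le> L ^ Suc n" by (rule one_le_power[OF L(1)])
  ultimately show ?thesis by blast
qed

lemma generatorD: "(x, y) \<in> generator T \<Longrightarrow> ((\<lambda>h. (T h x - x) /\<^sub>R h) \<longlongrightarrow> y) (at_right 0)"
  by (simp add: generator_def)

lemma generator_invariant:
  assumes xy: "(x, y) \<in> generator T" and s: "0 \<le> s"
  shows "(T s x, T s y) \<in> generator T"
proof -
  have "((\<lambda>h. T s ((T h x - x) /\<^sub>R h)) \<longlongrightarrow> T s y) (at_right 0)"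
    by (intro tendsto_intros generatorD[OF xy])
  moreover have "\<forall>\<^sub>F h in at_right 0. T s ((T h x - x) /\<^sub>R h) = (T h (T s x) - T s x) /\<^sub>R h"
    using eventually_at_right_less[of 0]
  proof eventually_elim
    case (elim h)
    then have "T s (T h x) = T h (T s x)" using semigroup_add[of s h x] semigroup_add[of h s x] s
      by (simp add: add.commute)
    then show ?case by (simp add: blinfun.scaleR_right blinfun.diff_right)
  qed
  ultimately show ?thesis
    unfolding generator_def by (auto intro: Lim_transform_eventually)
qed

lemma generator_diff:
  assumes "(x, y) \<in> generator T" "(u, v) \<in> generator T"
  shows "(x - u, y - v) \<in> generator T"
proof -
  have "((\<lambda>h. (T h x - x) /\<^sub>R h - (T h u - u) /\<^sub>R h) \<longlongrightarrow> y - v) (at_right 0)"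
    by (intro tendsto_diff generatorD assms)
  moreover have "(T h x - x) /\<^sub>R h - (T h u - u) /\<^sub>R h = (T h (x - u) - (x - u)) /\<^sub>R h" for h
    by (simp add: blinfun.diff_right scaleR_diff_right)
  ultimately show ?thesis by (simp add: generator_def)
qed

text \<open>
  The right derivative is immediate from the semigroup law. For the left one, the difference quotient
  at \<open>r < s\<close> is \<open>T r\<close> applied to a quotient at \<open>0\<close>, which needs the bound on the operators near \<open>s\<close>.
  Both cases are estimated by the same function of the distance \<open>h\<close> between \<open>r\<close> and \<open>s\<close>.
\<close>

lemma orbit_has_vector_derivative:
  assumes xy: "(x, y) \<in> generator T" and s: "0 < s"
  shows "((\<lambda>s. T s x) has_vector_derivative T s y) (at s)"
proof -
  obtain M where M: "1 \<le> M" "\<And>r. 0 \<le> r \<Longrightarrow> r \<le> 2 * s \<Longrightarrow> norm (T r) \<le> M"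
    using semigroup_bounded_on[of "2 * s"] by auto
  define g where "g h = M * (norm ((T h x - x) /\<^sub>R h - y) + norm (T h y - y))" for h
  have "(g \<longlongrightarrow> M * (norm (y - y) + norm (y - y))) (at_right 0)"
    unfolding g_def by (intro tendsto_intros generatorD[OF xy] semigroup_tendsto)
  then have g: "(g \<longlongrightarrow> 0) (at_right 0)" by simp
  have abs_lim: "filterlim (\<lambda>r. \<bar>r - s\<bar>) (at_right 0) (at s)"
  proof -
    have "((\<lambda>r. \<bar>r - s\<bar>) \<longlongrightarrow> \<bar>s - s\<bar>) (at s)" by (intro tendsto_intros)
    then show ?thesis by (simp add: filterlim_at eventually_at_filter)
  qed
  have bound: "norm (T r v) \<le> M * norm v" if "0 \<le> r" "r \<le> 2 * s" for r v
    using order.trans[OF norm_blinfun mult_right_mono[OF M(2)[OF that] norm_ge_zero]] .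
  have key: "norm ((T r x - T s x) - (r - s) *\<^sub>R T s y) / norm (r - s) \<le> g \<bar>r - s\<bar>"
    if r: "0 < r" "r < 2 * s" "r \<noteq> s" for r
  proof -
    define h where "h = \<bar>r - s\<bar>"
    define q where "q = (T h x - x) /\<^sub>R h - y"
    have h: "0 < h" using r by (simp add: h_def)
    have Th: "T h x = x + h *\<^sub>R y + h *\<^sub>R q" using h by (simp add: q_def scaleR_diff_right)
    have "norm ((T r x - T s x) - (r - s) *\<^sub>R T s y) \<le> h * (M * (norm q + norm (T h y - y)))"
    proof (cases "s < r")
      case True
      then have "T r x = T s (T h x)" "r - s = h"
        using semigroup_add[of s h x] s h by (simp_all add: h_def)
      then have "(T r x - T s x) - (r - s) *\<^sub>R T s y = h *\<^sub>R T s q"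
        unfolding Th by (simp add: blinfun.bilinear_simps)
      also have "norm \<dots> \<le> h * (M * norm q)"
        using bound[of s q] s h by simp
      also have "\<dots> \<le> h * (M * (norm q + norm (T h y - y)))"
        using h M(1) by (intro mult_left_mono) auto
      finally show ?thesis .
    next
      case False
      then have eq: "T s x = T r (T h x)" "T s y = T r (T h y)" "r - s = - h"
        using semigroup_add[of r h] r h by (simp_all add: h_def)
      have "(T r x - T s x) - (r - s) *\<^sub>R T s y = h *\<^sub>R T r ((T h y - y) - q)"
        unfolding eq unfolding Th by (simp add: blinfun.bilinear_simps algebra_simps)
      also have "norm \<dots> \<le> h * (M * norm ((T h y - y) - q))"
        using bound[of r] r h by simp
      also have "\<dots> \<le> h * (M * (norm q + norm (T h y - y)))"
        using h M(1) norm_triangle_ineq4[of "T h y - y" q] by (intro mult_left_mono) auto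
      finally show ?thesis .
    qed
    then have "norm ((T r x - T s x) - (r - s) *\<^sub>R T s y) \<le> g h * h"
      by (simp add: g_def q_def mult.commute)
    then have "norm ((T r x - T s x) - (r - s) *\<^sub>R T s y) / h \<le> g h"
      using h by (simp only: pos_divide_le_eq)
    then show ?thesis by (simp add: h_def)
  qed
  have "((\<lambda>r. norm ((T r x - T s x) - (r - s) *\<^sub>R T s y) / norm (r - s)) \<longlongrightarrow> 0) (at s)"
  proof (rule Lim_null_comparison)
    have "\<forall>\<^sub>F r in at s. r \<in> {0<..<2 * s}"
      using s by (intro eventually_at_in_open') auto
    moreover have "\<forall>\<^sub>F r in at s. r \<noteq> s" by (simp add: eventually_at_filter)
    ultimately show "\<forall>\<^sub>F r in at s. norm (norm ((T r x - T s x) - (r - s) *\<^sub>R T s y) / norm (r - s)) \<le> g \<bar>r - s\<bar>"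
      by eventually_elim (use key in auto)
    show "((\<lambda>r. g \<bar>r - s\<bar>) \<longlongrightarrow> 0) (at s)"
      by (rule filterlim_compose[OF g abs_lim])
  qed
  then show ?thesis
    unfolding has_vector_derivative_def has_derivative_iff_norm
    by (simp add: bounded_linear_scaleR_left)
qed

lemma orbit_continuous_on:
  assumes xy: "(x, y) \<in> generator T" and t: "0 < t"
  shows "continuous_on {0..t} (\<lambda>s. T s x)"
  unfolding continuous_on_def
proof
  fix s assume s: "s \<in> {0..t}"
  show "((\<lambda>s. T s x) \<longlongrightarrow> T s x) (at s within {0..t})"
  proof (cases "s = 0")
    case True
    then show ?thesis
      using semigroup_tendsto[of x] t by (simp add: at_within_Icc_at_right semigroup_0)
  next
    case False
    then have "0 < s" using s by simp
    then have "isCont (\<lambda>s. T s x) s"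
      by (rule has_vector_derivative_continuous[OF orbit_has_vector_derivative[OF xy]])
    then show ?thesis unfolding isCont_def by (rule tendsto_within_subset) simp
  qed
qed

end

text \<open>
  The difference \<open>d\<close> of two orbits from the same point satisfies \<open>d' = - H d\<close>, so \<open>\<parallel>d\<parallel>\<^sup>2\<close> has the
  derivative \<open>- 2 \<langle>d, H d\<rangle> \<le> 0\<close> and stays \<open>0\<close>. The starting points are taken in the dense domain.
\<close>

theorem C0_semigroup_unique:
  fixes T U :: "real \<Rightarrow> 'a::complex_hilbert \<Rightarrow>\<^sub>L 'a"
  assumes T: "C0_semigroup T" and U: "C0_semigroup U"
    and gT: "generator T = op_minus H" and gU: "generator U = op_minus H"
    and H: "bounded_below H \<mu>" and \<mu>: "0 \<le> \<mu>" and dense: "densely_defined H" and t: "0 \<le> t"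
  shows "T t = U t"
proof (cases "t = 0")
  case True
  then show ?thesis using T U by (simp add: C0_semigroup_def)
next
  case False
  then have t: "0 < t" using t by simp
  have dissipative: "x \<bullet> y \<le> 0" if "(x, y) \<in> op_minus H" for x y
  proof -
    have "(x, - y) \<in> H" using that by (auto simp: op_minus_def)
    then have "\<mu> * (norm x)\<^sup>2 \<le> x \<bullet> - y"
      using H unfolding bounded_below_def inner_eq_Re_cinner by blast
    moreover have "0 \<le> \<mu> * (norm x)\<^sup>2" using \<mu> by simp
    ultimately show ?thesis by simp
  qed
  have eq: "T t x = U t x" if x: "(x, y) \<in> op_minus H" for x y
  proof -
    have xT: "(x, y) \<in> generator T" and xU: "(x, y) \<in> generator U" using x gT gU by auto
    define d where "d s = T s x - U s x" for s
    have "d t \<bullet> d t \<le> d 0 \<bullet> d 0"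
    proof (rule DERIV_nonpos_imp_decreasing_open[of 0 t])
      show "0 \<le> t" using t by simp
      show "continuous_on {0..t} (\<lambda>s. d s \<bullet> d s)"
        unfolding d_def
        by (intro continuous_intros orbit_continuous_on[OF T xT t] orbit_continuous_on[OF U xU t])
      fix s assume s: "0 < s" "s < t"
      let ?e = "T s y - U s y"
      have "(T s x, T s y) \<in> generator T" "(U s x, U s y) \<in> generator T"
        using generator_invariant[OF T xT, of s] generator_invariant[OF U xU, of s] s gT gU by auto
      then have "(d s, ?e) \<in> op_minus H"
        unfolding d_def gT[symmetric] by (rule generator_diff[OF T])
      then have "d s \<bullet> ?e \<le> 0" by (rule dissipative)
      moreover have "(d has_vector_derivative ?e) (at s)"
        unfolding d_def
        by (intro derivative_intros orbit_has_vector_derivative[OF T xT] orbit_has_vector_derivative[OF U xU] s)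
      then have "((\<lambda>s. d s \<bullet> d s) has_vector_derivative (d s \<bullet> ?e + ?e \<bullet> d s)) (at s)"
        by (intro bounded_bilinear.has_vector_derivative[OF bounded_bilinear_inner])
      then have "((\<lambda>s. d s \<bullet> d s) has_real_derivative (d s \<bullet> ?e + ?e \<bullet> d s)) (at s)"
        by (simp only: has_real_derivative_iff_has_vector_derivative)
      ultimately show "\<exists>y. DERIV (\<lambda>s. d s \<bullet> d s) s :> y \<and> y \<le> 0"
        by (intro exI[of _ "d s \<bullet> ?e + ?e \<bullet> d s"]) (simp add: inner_commute)
    qed
    also have "d 0 \<bullet> d 0 = 0" by (simp add: d_def semigroup_0[OF T] semigroup_0[OF U])
    finally have "d t = 0" using inner_ge_zero[of "d t"] by (metis inner_eq_zero_iff order.antisym)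
    then show ?thesis by (simp add: d_def)
  qed
  have "Domain H \<subseteq> {x. T t x = U t x}"
  proof
    fix x assume "x \<in> Domain H"
    then obtain y where "(x, y) \<in> H" by blast
    then have "(x, - y) \<in> op_minus H" by (auto simp: op_minus_def)
    then show "x \<in> {x. T t x = U t x}" using eq by blast
  qed
  moreover have "closed {x. T t x = U t x}" by (intro closed_Collect_eq continuous_intros)
  ultimately have "closure (Domain H) \<subseteq> {x. T t x = U t x}" by (rule closure_minimal)
  then show ?thesis using dense by (auto simp: densely_defined_def intro: blinfun_eqI)
qed

section \<open>Self-adjoint operators with a positive lower bound\<close>

text \<open>
  A minimizing sequence of the distance from \<open>x\<close> to \<open>M\<close> is Cauchy by the
  parallelogram identity, and its limit is the foot of the perpendicular.
\<close>

lemma orthogonal_projection_exists: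
  fixes M :: "'a::{real_inner,complete_space} set"
  assumes M: "closed M" "subspace M"
  obtains p where "p \<in> M" "\<And>m. m \<in> M \<Longrightarrow> (x - p) \<bullet> m = 0"
proof -
  define d where "d = (INF m\<in>M. norm (x - m))"
  have ne: "M \<noteq> {}" using M(2) subspace_0 by blast
  have bdd: "bdd_below ((\<lambda>m. norm (x - m)) ` M)" by (rule bdd_belowI[of _ 0]) auto
  have d_le: "d \<le> norm (x - m)" if "m \<in> M" for m
    unfolding d_def by (rule cINF_lower[OF bdd that])
  have d0: "0 \<le> d" unfolding d_def by (rule cINF_greatest[OF ne]) simp
  have "\<exists>m\<in>M. norm (x - m) < d + e" if "0 < e" for e
    using cINF_less_iff[OF ne bdd, of "d + e"] that by (simp add: d_def)
  then have "\<forall>n. \<exists>m\<in>M. norm (x - m) < d + inverse (real (Suc n))" by simp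
  then obtain f where f: "\<And>n. f n \<in> M" "\<And>n. norm (x - f n) < d + inverse (real (Suc n))" by metis
  have lim: "(\<lambda>n. norm (x - f n)) \<longlonglongrightarrow> d"
  proof (rule real_tendsto_sandwich[of "\<lambda>_. d"])
    show "(\<lambda>n. d + inverse (real (Suc n))) \<longlonglongrightarrow> d"
      using tendsto_add[OF tendsto_const LIMSEQ_inverse_real_of_nat, of d] by simp
    show "\<forall>\<^sub>F n in sequentially. d \<le> norm (x - f n)"
      by (intro always_eventually allI d_le f)
    show "\<forall>\<^sub>F n in sequentially. norm (x - f n) \<le> d + inverse (real (Suc n))"
      by (intro always_eventually allI less_imp_le f)
  qed simp
  have parallelogram: "(norm (f m - f n))\<^sup>2 \<le> 2 * ((norm (x - f m))\<^sup>2 - d\<^sup>2) + 2 * ((norm (x - f n))\<^sup>2 - d\<^sup>2)" for m n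
  proof -
    have "(1/2) *\<^sub>R (f m + f n) \<in> M" using M(2) f(1) by (intro subspace_mul subspace_add)
    then have "d \<le> norm (x - (1/2) *\<^sub>R (f m + f n))" by (rule d_le)
    then have "d\<^sup>2 \<le> (norm (x - (1/2) *\<^sub>R (f m + f n)))\<^sup>2" using d0 by (rule power_mono)
    moreover have "(norm (f m - f n))\<^sup>2 = 2 * (norm (x - f m))\<^sup>2 + 2 * (norm (x - f n))\<^sup>2
        - 4 * (norm (x - (1/2) *\<^sub>R (f m + f n)))\<^sup>2"
      by (simp add: power2_norm_eq_inner inner_simps inner_commute algebra_simps)
    ultimately show ?thesis by simp
  qed
  have "Cauchy f"
  proof (rule metric_CauchyI)
    fix e :: real assume e: "0 < e"
    have "(\<lambda>n. 2 * ((norm (x - f n))\<^sup>2 - d\<^sup>2)) \<longlonglongrightarrow> 2 * (d\<^sup>2 - d\<^sup>2)"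
      by (intro tendsto_intros lim)
    then have "\<forall>\<^sub>F n in sequentially. 2 * ((norm (x - f n))\<^sup>2 - d\<^sup>2) < e\<^sup>2 / 2"
      by (rule order_tendstoD) (use e in simp)
    then obtain N where N: "\<And>n. N \<le> n \<Longrightarrow> 2 * ((norm (x - f n))\<^sup>2 - d\<^sup>2) < e\<^sup>2 / 2"
      by (auto simp: eventually_sequentially)
    have "dist (f m) (f n) < e" if "N \<le> m" "N \<le> n" for m n
    proof -
      have "(norm (f m - f n))\<^sup>2 < e\<^sup>2" using parallelogram[of m n] N[OF that(1)] N[OF that(2)] by linarith
      then show ?thesis using e by (simp add: dist_norm power_less_imp_less_base)
    qed
    then show "\<exists>N. \<forall>m\<ge>N. \<forall>n\<ge>N. dist (f m) (f n) < e" by blast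
  qed
  then obtain p where p: "f \<longlonglongrightarrow> p" using Cauchy_convergent_iff convergent_def by blast
  have pM: "p \<in> M" using closed_sequentially[OF M(1)] f(1) p by blast
  have "(\<lambda>n. norm (x - f n)) \<longlonglongrightarrow> norm (x - p)" by (intro tendsto_intros p)
  then have dp: "norm (x - p) = d" using LIMSEQ_unique lim by blast
  have "(x - p) \<bullet> m = 0" if m: "m \<in> M" for m
  proof (rule ccontr)
    assume nz: "(x - p) \<bullet> m \<noteq> 0"
    then have m0: "m \<noteq> 0" by auto
    define c where "c = ((x - p) \<bullet> m) / (m \<bullet> m)"
    have "p + c *\<^sub>R m \<in> M" using M(2) pM m by (intro subspace_add subspace_mul)
    then have "(norm (x - p))\<^sup>2 \<le> (norm (x - (p + c *\<^sub>R m)))\<^sup>2"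
      unfolding dp using d_le d0 by (intro power_mono)
    also have "\<dots> = (norm (x - p))\<^sup>2 - 2 * c * ((x - p) \<bullet> m) + c * c * (m \<bullet> m)"
      by (simp add: power2_norm_eq_inner inner_simps inner_commute algebra_simps)
    also have "c * c * (m \<bullet> m) = c * ((x - p) \<bullet> m)" using m0 by (simp add: c_def)
    finally have "c * ((x - p) \<bullet> m) \<le> 0" by simp
    moreover have "c * ((x - p) \<bullet> m) = ((x - p) \<bullet> m)\<^sup>2 / (m \<bullet> m)"
      by (simp add: c_def power2_eq_square)
    moreover have "0 < ((x - p) \<bullet> m)\<^sup>2 / (m \<bullet> m)" using nz m0 by (intro divide_pos_pos) auto
    ultimately show False by linarith
  qed
  with pM show ?thesis by (rule that)
qed

lemma cinner_eq_of_inner: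
  assumes "\<And>c. inner u (c *\<^sub>C y) = inner v (c *\<^sub>C x)"
  shows "cinner u y = cinner v x"
proof (rule complex_eqI)
  show "Re (cinner u y) = Re (cinner v x)"
    using assms[of 1] by (simp add: inner_eq_Re_cinner cinner_scaleC_right)
  show "Im (cinner u y) = Im (cinner v x)"
    using assms[of "\<i>"] by (simp add: inner_eq_Re_cinner cinner_scaleC_right)
qed

text \<open>
  For a complex-linear operator the real inner product determines the adjoint, since the imaginary
  part of \<open>cinner\<close> is, up to sign, its real part after multiplying one argument by \<open>\<i>\<close>.
\<close>

lemma adjoint_operator_iff:
  assumes A: "linear_operator A"
  shows "(u, v) \<in> adjoint_operator A \<longleftrightarrow> (\<forall>x y. (x, y) \<in> A \<longrightarrow> u \<bullet> y = v \<bullet> x)"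
proof
  assume "(u, v) \<in> adjoint_operator A"
  then show "\<forall>x y. (x, y) \<in> A \<longrightarrow> u \<bullet> y = v \<bullet> x"
    by (auto simp: adjoint_operator_def inner_eq_Re_cinner)
next
  assume *: "\<forall>x y. (x, y) \<in> A \<longrightarrow> u \<bullet> y = v \<bullet> x"
  have "cinner u y = cinner v x" if "(x, y) \<in> A" for x y
    using that A * by (intro cinner_eq_of_inner) (auto simp: linear_operator_def)
  then show "(u, v) \<in> adjoint_operator A" by (simp add: adjoint_operator_def)
qed

lemma self_adjoint_iff:
  "self_adjoint H \<Longrightarrow> (u, v) \<in> H \<longleftrightarrow> (\<forall>x y. (x, y) \<in> H \<longrightarrow> u \<bullet> y = v \<bullet> x)"
  using adjoint_operator_iff[of H u v] by (simp add: self_adjoint_def)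

lemma scaleC_of_real: "complex_of_real r *\<^sub>C x = r *\<^sub>R x"
  by (simp add: scaleR_scaleC)

text \<open>
  The lower bound makes \<open>H\<close> injective with closed range, and a vector orthogonal to the range lies in
  the kernel of the adjoint, which is the kernel of \<open>H\<close>. So \<open>H\<close> is onto and has a bounded inverse.
\<close>

lemma self_adjoint_bounded_inverse:
  fixes H :: "'a::complex_hilbert operator"
  assumes H: "self_adjoint H" and below: "bounded_below H \<mu>" and \<mu>: "0 < \<mu>"
  obtains K where "H = (graph_of K)\<inverse>" "positive_op K" "K \<in> bounded_operators"
    "closure (range (blinfun_apply K)) = UNIV"
proof -
  have lin: "linear_operator H" using H by (simp add: self_adjoint_def)
  have add: "(x, y) \<in> H \<Longrightarrow> (u, v) \<in> H \<Longrightarrow> (x + u, y + v) \<in> H" for x y u v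
    using lin by (simp add: linear_operator_def)
  have scaleC: "(x, y) \<in> H \<Longrightarrow> (c *\<^sub>C x, c *\<^sub>C y) \<in> H" for c x y
    using lin by (simp add: linear_operator_def)
  have scale: "(x, y) \<in> H \<Longrightarrow> (r *\<^sub>R x, r *\<^sub>R y) \<in> H" for r x y
    using scaleC[of x y "complex_of_real r"] by (simp add: scaleC_of_real)
  have zero: "(0, 0) \<in> H" using lin by (simp add: linear_operator_def)
  have diff: "(x, y) \<in> H \<Longrightarrow> (u, v) \<in> H \<Longrightarrow> (x - u, y - v) \<in> H" for x y u v
    using add[of x y "-u" "-v"] scale[of u v "-1"] by simp
  have form: "\<mu> * (x \<bullet> x) \<le> x \<bullet> y" if "(x, y) \<in> H" for x y
    using below that by (auto simp: bounded_below_def inner_eq_Re_cinner power2_norm_eq_inner)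
  have norm_le: "norm x \<le> norm y * (1 / \<mu>)" if "(x, y) \<in> H" for x y
  proof -
    have "\<mu> * (norm x * norm x) \<le> norm x * norm y"
      using form[OF that] norm_cauchy_schwarz[of x y]
      by (simp add: power2_norm_eq_inner[symmetric] power2_eq_square)
    then have "norm x * (\<mu> * norm x) \<le> norm x * norm y" by (simp add: mult.left_commute)
    then have "\<mu> * norm x \<le> norm y"
      by (cases "x = 0") auto
    then show ?thesis using \<mu> by (simp add: field_simps)
  qed
  have inj: "x = u" if "(x, y) \<in> H" "(u, y) \<in> H" for x u y
    using norm_le[OF diff[OF that]] by simp
  have closed: "closed (Range H)"
    unfolding closed_sequential_limits
  proof (intro allI impI, elim conjE)
    fix y l assume l: "y \<longlonglongrightarrow> l" and "\<forall>n. y n \<in> Range H"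
    then have "\<forall>n. \<exists>x. (x, y n) \<in> H" by blast
    then obtain x where xy: "\<And>n. (x n, y n) \<in> H" by metis
    have "Cauchy x"
    proof (rule metric_CauchyI)
      fix e :: real assume "0 < e"
      then have "0 < \<mu> * e" using \<mu> by simp
      then obtain N where N: "\<And>m n. N \<le> m \<Longrightarrow> N \<le> n \<Longrightarrow> dist (y m) (y n) < \<mu> * e"
        using metric_CauchyD[OF LIMSEQ_imp_Cauchy[OF l]] by meson
      have "dist (x m) (x n) < e" if "N \<le> m" "N \<le> n" for m n
      proof -
        have "norm (x m - x n) * \<mu> \<le> norm (y m - y n)"
          using norm_le[OF diff[OF xy[of m] xy[of n]]] \<mu> by (simp add: field_simps)
        also have "\<dots> < e * \<mu>" using N[OF that] by (simp add: dist_norm mult.commute)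
        finally show ?thesis using \<mu> by (simp add: dist_norm)
      qed
      then show "\<exists>N. \<forall>m\<ge>N. \<forall>n\<ge>N. dist (x m) (x n) < e"
        by (intro exI[of _ N]) simp
    qed
    then obtain k where k: "x \<longlonglongrightarrow> k"
      using Cauchy_convergent[of x] by (auto simp: convergent_def)
    have "k \<bullet> v = l \<bullet> u" if uv: "(u, v) \<in> H" for u v
    proof (rule LIMSEQ_unique)
      show "(\<lambda>n. x n \<bullet> v) \<longlonglongrightarrow> k \<bullet> v" by (intro tendsto_intros k)
      have "x n \<bullet> v = y n \<bullet> u" for n using self_adjoint_iff[OF H] xy uv by blast
      moreover have "(\<lambda>n. y n \<bullet> u) \<longlonglongrightarrow> l \<bullet> u" by (intro tendsto_intros l)
      ultimately show "(\<lambda>n. x n \<bullet> v) \<longlonglongrightarrow> l \<bullet> u" by simp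
    qed
    then have "(k, l) \<in> H" using self_adjoint_iff[OF H] by blast
    then show "l \<in> Range H" by blast
  qed
  have subspace: "subspace (Range H)"
    unfolding subspace_def Range_iff using zero add scale by blast
  have surj: "y \<in> Range H" for y
  proof -
    obtain p where p: "p \<in> Range H" "\<And>m. m \<in> Range H \<Longrightarrow> (y - p) \<bullet> m = 0"
      using orthogonal_projection_exists[OF closed subspace] by blast
    have "\<forall>u v. (u, v) \<in> H \<longrightarrow> (y - p) \<bullet> v = 0 \<bullet> u" by (auto intro!: p(2))
    then have "(y - p, 0) \<in> H" by (rule iffD2[OF self_adjoint_iff[OF H]])
    then have "y - p = 0" using inj[OF _ zero] by blast
    then show ?thesis using p(1) by simp
  qed
  define g where "g y = (THE x. (x, y) \<in> H)" for y
  have g: "(g y, y) \<in> H" for y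
    unfolding g_def using surj[of y] inj by (intro theI'[of "\<lambda>x. (x, y) \<in> H"]) blast
  have g_eq: "(x, y) \<in> H \<Longrightarrow> g y = x" for x y using inj g by blast
  have blin: "bounded_linear g"
    using norm_le[OF g] g_eq[OF add[OF g g]] g_eq[OF scale[OF g]]
    by (intro bounded_linear_intro[of g "1 / \<mu>"]) auto
  define K where "K = Blinfun g"
  have K: "K y = g y" for y by (simp add: K_def bounded_linear_Blinfun_apply[OF blin])
  have H_eq: "H = (graph_of K)\<inverse>"
    using g g_eq by (auto simp: graph_of_def K)
  have pos: "positive_op K"
    unfolding positive_op_def symmetric_op_def K
  proof (intro conjI allI)
    show "g x \<bullet> y = x \<bullet> g y" for x y using self_adjoint_iff[OF H] g by blast
    have "0 \<le> \<mu> * (g x \<bullet> g x)" for x using \<mu> by simp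
    then show "0 \<le> x \<bullet> g x" for x using form[OF g[of x]] by (metis inner_commute order_trans)
  qed
  have cplx: "K \<in> bounded_operators"
    using g_eq[OF scaleC[OF g]] by (simp add: bounded_operators_def K)
  have "Domain H = range (blinfun_apply K)" unfolding H_eq by (auto simp: graph_of_def)
  then have "closure (range (blinfun_apply K)) = UNIV"
    using H by (simp add: self_adjoint_def densely_defined_def)
  with H_eq pos cplx show ?thesis by (rule that)
qed

lemma bounded_inverse_eqI:
  assumes "graph_of B = A\<inverse>"
  shows "bounded_inverse A = B"
  unfolding bounded_inverse_def
proof (rule the_equality, rule assms)
  fix C assume "graph_of C = A\<inverse>"
  then have "graph_of C = graph_of B" using assms by simp
  then show "C = B" by (intro blinfun_eqI) (auto simp: graph_of_def set_eq_iff)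
qed

lemma bounded_inverse_id_plus:
  fixes K :: "'a::complex_hilbert \<Rightarrow>\<^sub>L 'a"
  assumes K: "positive_op K"
  shows "bounded_inverse (id_plus ((graph_of K)\<inverse>)) = resolvent K 1"
proof (rule bounded_inverse_eqI)
  have "(x, y) \<in> graph_of (resolvent K 1) \<longleftrightarrow> (x, y) \<in> (id_plus ((graph_of K)\<inverse>))\<inverse>" for x y
  proof -
    obtain w where w: "x = K w + 1 *\<^sub>R w" by (rule shifted_surj[OF K zero_less_one])
    have R: "resolvent K 1 x = K w" unfolding w by (rule resolvent_apply[OF K]) simp
    have uniq: "v = w" if "x = K v + v" for v
      using shifted_inverse(1)[OF K, of 1 v] shifted_inverse(1)[OF K, of 1 w] that w by simp
    have "(x, y) \<in> graph_of (resolvent K 1) \<longleftrightarrow> y = K w"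
      by (auto simp: graph_of_def R)
    also have "\<dots> \<longleftrightarrow> (\<exists>v. y = K v \<and> x = K v + v)"
      using uniq w by (metis scaleR_one)
    also have "\<dots> \<longleftrightarrow> (x, y) \<in> (id_plus ((graph_of K)\<inverse>))\<inverse>"
      by (auto simp: graph_of_def id_plus_def)
    finally show ?thesis .
  qed
  then show "graph_of (resolvent K 1) = (id_plus ((graph_of K)\<inverse>))\<inverse>" by auto
qed

text \<open>
  As the left side does not involve \<open>\<theta>\<close>, the semigroups of all grids agree.
\<close>

theorem exp_semigroup_eq_grid:
  fixes H :: "'a::complex_hilbert operator"
  assumes H_eq: "H = (graph_of K)\<inverse>" and grid: "grid K \<theta>" and t: "0 \<le> t"
  shows "exp_semigroup (op_minus H) t = grid_semigroup K \<theta> t"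
proof -
  interpret grid K \<theta> by (rule grid)
  have pos: "bounded_below H 0"
    using K unfolding H_eq bounded_below_def graph_of_def positive_op_def
    by (auto simp: inner_eq_Re_cinner[symmetric] inner_commute)
  have "Domain H = range (blinfun_apply K)" unfolding H_eq by (auto simp: graph_of_def)
  then have dense: "densely_defined H" using K_dense by (simp add: densely_defined_def)
  have "C0_semigroup (grid_semigroup K \<theta>) \<and> generator (grid_semigroup K \<theta>) = op_minus H"
    unfolding H_eq using C0_semigroup_grid generator_grid by blast
  then show ?thesis
    unfolding exp_semigroup_def
    by (intro the_equality) (auto intro: C0_semigroup_unique[OF _ _ _ _ pos _ dense t])
qed

section \<open>The rate of convergence of the Chernoff approximation\<close>

lemma op_nonneg_imp_positive_op: "op_nonneg A \<Longrightarrow> positive_op A"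
  by (simp add: op_nonneg_def bounded_self_adjoint_def positive_op_def symmetric_op_def
      inner_eq_Re_cinner)

lemma positive_contractionI:
  assumes A: "positive_op A" and norm: "norm A \<le> 1"
  shows "positive_contraction A"
proof -
  have "x \<bullet> A x \<le> x \<bullet> x" for x
  proof -
    have "norm (A x) \<le> 1 * norm x"
      by (rule order.trans[OF norm_blinfun mult_right_mono[OF norm norm_ge_zero]])
    then have "norm x * norm (A x) \<le> norm x * norm x" by (intro mult_left_mono) auto
    then show ?thesis
      using norm_cauchy_schwarz[of x "A x"] by (simp add: power2_norm_eq_inner[symmetric] power2_eq_square)
  qed
  then show ?thesis using A by (simp add: positive_contraction_alt positive_op_def)
qed

lemma norm_le_of_op_le:
  assumes F: "op_nonneg F" and \<delta>: "\<delta> < 1" and le: "op_le F ((1 - \<delta>) *\<^sub>R id_blinfun)"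
  shows "norm F \<le> 1 - \<delta>"
proof (rule norm_le_of_form_le)
  show "positive_op F" by (rule op_nonneg_imp_positive_op[OF F])
  show "x \<bullet> F x \<le> (1 - \<delta>) * (x \<bullet> x)" for x
    using op_nonneg_imp_positive_op[OF le[unfolded op_le_def]]
    by (simp add: positive_op_def blinfun.diff_left blinfun.scaleR_left inner_diff_right)
qed (use \<delta> in simp)

lemma positive_op_inverse:
  fixes A B :: "'a::real_inner \<Rightarrow>\<^sub>L 'a"
  assumes A: "positive_op A" and inv: "\<And>x. A (B x) = x"
  shows "positive_op B"
  unfolding positive_op_def symmetric_op_def
proof (intro conjI allI)
  fix x y
  show "B x \<bullet> y = x \<bullet> B y"
    using A inv unfolding positive_op_def symmetric_op_def by metis
  have "0 \<le> B x \<bullet> A (B x)" using A by (simp add: positive_op_def)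
  then show "0 \<le> x \<bullet> B x" by (simp add: inv inner_commute)
qed

text \<open>
  The resolvent of the inverse of \<open>K\<close> at \<open>1\<close> is \<open>1 - (1 + K)\<^sup>-\<^sup>1\<close>, so the difference in the middle is
  \<open>(1 + K)\<^sup>-\<^sup>1 - (1 + U)\<^sup>-\<^sup>1\<close>.
\<close>

lemma inverse_difference_eq:
  fixes K U :: "'a::complex_hilbert \<Rightarrow>\<^sub>L 'a"
  assumes K: "positive_op K" and U: "positive_op U"
  shows "U - K = (id_blinfun + K) o\<^sub>L (resolvent U 1 - resolvent K 1) o\<^sub>L (id_blinfun + U)"
proof (rule blinfun_eqI)
  fix x
  obtain w where w: "U x + 1 *\<^sub>R x = K w + 1 *\<^sub>R w" by (rule shifted_surj[OF K zero_less_one])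
  have "resolvent U 1 (U x + 1 *\<^sub>R x) = U x" by (rule resolvent_apply[OF U zero_less_one])
  moreover have "resolvent K 1 (U x + 1 *\<^sub>R x) = K w"
    unfolding w by (rule resolvent_apply[OF K zero_less_one])
  moreover have "K (U x) + K x = K (K w) + K w"
    using arg_cong[OF w, of K] by (simp add: blinfun.add_right)
  ultimately show "(U - K) x = ((id_blinfun + K) o\<^sub>L (resolvent U 1 - resolvent K 1) o\<^sub>L (id_blinfun + U)) x"
    by (simp add: blinfun.add_left blinfun.diff_left blinfun.diff_right add.commute algebra_simps)
qed

text \<open>
  The factorization bounds \<open>\<parallel>U - K\<parallel>\<close> by a multiple of \<open>\<rho> (1 + \<parallel>U\<parallel>)\<close>. As \<open>\<parallel>U\<parallel> \<le> \<parallel>K\<parallel> + \<parallel>U - K\<parallel>\<close>, the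
  second term is absorbed into the left side when \<open>\<rho>\<close> is small.
\<close>

lemma norm_inverse_difference_le:
  fixes K U :: "'a::complex_hilbert \<Rightarrow>\<^sub>L 'a"
  assumes K: "positive_op K" and U: "positive_op U"
    and \<rho>: "norm (resolvent U 1 - resolvent K 1) \<le> \<rho>" and small: "(1 + norm K) * \<rho> \<le> 1 / 2"
  shows "norm (U - K) \<le> 2 * (1 + norm K)\<^sup>2 * \<rho>"
proof -
  let ?a = "1 + norm K"
  have \<rho>0: "0 \<le> \<rho>" using \<rho> norm_ge_zero order.trans by blast
  have id_add: "norm (id_blinfun + A) \<le> 1 + norm A" for A :: "'a \<Rightarrow>\<^sub>L 'a"
    by (rule order.trans[OF norm_triangle_ineq]) (simp add: norm_blinfun_id_le)
  have "norm U \<le> norm K + norm (U - K)" using norm_triangle_ineq[of K "U - K"] by simp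
  then have aU: "1 + norm U \<le> ?a + norm (U - K)" by simp
  have "norm (U - K) \<le> norm (id_blinfun + K) * norm (resolvent U 1 - resolvent K 1) * norm (id_blinfun + U)"
    unfolding inverse_difference_eq[OF K U]
    by (intro order.trans[OF norm_blinfun_compose] mult_right_mono norm_blinfun_compose norm_ge_zero)
  also have "\<dots> \<le> ?a * \<rho> * (1 + norm U)"
    using \<rho> \<rho>0 by (intro mult_mono id_add mult_nonneg_nonneg) auto
  also have "\<dots> \<le> ?a * \<rho> * (?a + norm (U - K))"
    using \<rho>0 aU by (intro mult_left_mono mult_nonneg_nonneg) auto
  also have "\<dots> = ?a * \<rho> * ?a + ?a * \<rho> * norm (U - K)" by (rule distrib_left)
  also have "\<dots> \<le> ?a * \<rho> * ?a + 1 / 2 * norm (U - K)"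
    using small by (intro add_left_mono mult_right_mono) auto
  finally have "norm (U - K) \<le> 2 * (?a * \<rho> * ?a)" by simp
  also have "\<dots> = 2 * ?a\<^sup>2 * \<rho>" by (simp add: power2_eq_square)
  finally show ?thesis .
qed

text \<open>
  \<open>A\<close> is a right inverse of \<open>1 - F\<close>, and \<open>1 + K / \<tau>\<close> is the inverse of \<open>1 - R(\<tau>)\<close>.
\<close>

lemma contraction_minus_resolvent:
  fixes K F A :: "'a::complex_hilbert \<Rightarrow>\<^sub>L 'a"
  assumes K: "positive_op K" and \<tau>: "0 < \<tau>" and inv: "\<And>x. A x - F (A x) = x"
  shows "F - resolvent K \<tau> = (id_blinfun - F) o\<^sub>L (A - id_blinfun - (1 / \<tau>) *\<^sub>R K)
           o\<^sub>L (id_blinfun - resolvent K \<tau>)"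
proof (rule blinfun_eqI)
  fix x
  obtain w where w: "x = K w + \<tau> *\<^sub>R w" by (rule shifted_surj[OF K \<tau>])
  have R: "resolvent K \<tau> x = K w" unfolding w by (rule resolvent_apply[OF K \<tau>])
  have "(id_blinfun - resolvent K \<tau>) x = \<tau> *\<^sub>R w"
    unfolding blinfun.diff_left R by (simp add: w)
  moreover have "(A - id_blinfun - (1 / \<tau>) *\<^sub>R K) (\<tau> *\<^sub>R w) = \<tau> *\<^sub>R A w - x"
    using \<tau> by (simp add: blinfun.diff_left blinfun.scaleR_left blinfun.scaleR_right w
        scaleR_diff_right)
  moreover have "(id_blinfun - F) (\<tau> *\<^sub>R A w - x) = \<tau> *\<^sub>R (A w - F (A w)) - (x - F x)"
    by (simp add: blinfun.diff_left blinfun.diff_right blinfun.scaleR_right scaleR_diff_right)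
  moreover have "\<tau> *\<^sub>R (A w - F (A w)) - (x - F x) = F x - K w"
    unfolding inv by (simp add: w)
  ultimately show "(F - resolvent K \<tau>) x = ((id_blinfun - F) o\<^sub>L (A - id_blinfun - (1 / \<tau>) *\<^sub>R K)
      o\<^sub>L (id_blinfun - resolvent K \<tau>)) x"
    by (simp only: blinfun_apply_blinfun_compose blinfun.diff_left R)
qed

lemma contraction_power_rate:
  fixes K F A :: "'a::complex_hilbert \<Rightarrow>\<^sub>L 'a"
  assumes K: "positive_op K" and \<tau>: "0 < \<tau>" and F: "positive_contraction F"
    and inv: "\<And>x. A x - F (A x) = x" and n: "1 \<le> n"
  shows "norm (op_power F n - op_power (resolvent K \<tau>) n)
           \<le> 80 * norm (A - id_blinfun - (1 / \<tau>) *\<^sub>R K) / real n"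
proof (rule norm_power_minus_power_le[OF F positive_contraction_resolvent[OF K \<tau>]
      contraction_minus_resolvent[OF K \<tau> inv] _ n])
  have "positive_op A"
  proof (rule positive_op_inverse)
    show "positive_op (id_blinfun - F)" using F by (simp add: positive_contraction_def)
    show "(id_blinfun - F) (A x) = x" for x by (simp add: blinfun.diff_left inv)
  qed
  then show "symmetric_op (A - id_blinfun - (1 / \<tau>) *\<^sub>R K)"
    using K by (simp add: positive_op_def symmetric_op_def blinfun.diff_left blinfun.scaleR_left
        inner_diff_left inner_diff_right)
qed

lemma graph_of_chernoff_quotient:
  fixes F :: "real \<Rightarrow> 'a::complex_hilbert \<Rightarrow>\<^sub>L 'a" and A :: "'a \<Rightarrow>\<^sub>L 'a"
  assumes \<tau>: "0 < \<tau>" and inv: "\<And>x. A x - F \<tau> (A x) = x" "\<And>x. A (x - F \<tau> x) = x"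
  shows "graph_of (chernoff_quotient F \<tau>) = (graph_of (\<tau> *\<^sub>R A))\<inverse>"
proof -
  have S: "chernoff_quotient F \<tau> x = (1 / \<tau>) *\<^sub>R (x - F \<tau> x)" for x
    by (simp add: chernoff_quotient_def blinfun.diff_left blinfun.scaleR_left divide_inverse)
  have "chernoff_quotient F \<tau> ((\<tau> *\<^sub>R A) y) = y" for y
    using \<tau> inv(1)[of y] by (simp add: S blinfun.scaleR_left blinfun.scaleR_right scaleR_diff_right[symmetric])
  moreover have "(\<tau> *\<^sub>R A) (chernoff_quotient F \<tau> x) = x" for x
    using \<tau> by (simp add: S blinfun.scaleR_left blinfun.scaleR_right inv(2))
  ultimately show ?thesis by (auto simp: graph_of_def)
qed

theorem theorem3p7:
  fixes F :: "real \<Rightarrow> ('a::complex_hilbert \<Rightarrow>\<^sub>L 'a)"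
    and H :: "'a operator"
    and \<mu> :: real
  defines "S \<equiv> chernoff_quotient F"
  assumes measurable: "measurable_family F"
    and nonneg: "\<And>\<tau>. \<tau> \<ge> 0 \<Longrightarrow> op_nonneg (F \<tau>)"
    and contraction: "\<And>\<tau>. \<tau> \<ge> 0 \<Longrightarrow> norm (F \<tau>) \<le> 1"
    and F0: "F 0 = id_blinfun"
    and H: "self_adjoint H"
    and mu: "\<mu> > 0"
    and H_ge: "bounded_below H \<mu>"
    and slim: "strong_limit (\<lambda>\<tau>. bounded_inverse (id_plus (graph_of (S \<tau>))))
                 (bounded_inverse (id_plus H)) (at_right 0)"
    and gap: "\<forall>\<epsilon>>0. \<exists>\<delta>. 0 < \<delta> \<and> \<delta> < 1 \<and>
                (\<forall>\<tau>\<ge>\<epsilon>. op_le 0 (F \<tau>) \<and> op_le (F \<tau>) ((1 - \<delta>) *\<^sub>R id_blinfun))"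
    and rate: "\<exists>\<epsilon>\<^sub>0 M\<^sub>1. 0 < \<epsilon>\<^sub>0 \<and> \<epsilon>\<^sub>0 \<le> 1 \<and> M\<^sub>1 > 0 \<and>
                (\<forall>\<tau>. 0 < \<tau> \<and> \<tau> < \<epsilon>\<^sub>0 \<longrightarrow>
                   norm (bounded_inverse (id_plus (graph_of (S \<tau>))) - bounded_inverse (id_plus H))
                     \<le> M\<^sub>1 * \<tau>)"
  shows "\<exists>c\<^sub>1>0. \<forall>n::nat. n \<ge> 1 \<longrightarrow>
           (SUP t\<in>{0..}. ereal (norm (op_power (F (t / real n)) n - exp_semigroup (op_minus H) t)))
             \<le> ereal (c\<^sub>1 * (1 / real n))"
proof -
  obtain K where H_eq: "H = (graph_of K)\<inverse>" and K: "positive_op K" and K_complex: "K \<in> bounded_operators"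
    and K_dense: "closure (range (blinfun_apply K)) = UNIV"
    by (rule self_adjoint_bounded_inverse[OF H H_ge mu])
  have grid: "grid K \<theta>" if "0 < \<theta>" for \<theta>
    using K K_complex K_dense that by unfold_locales
  obtain \<epsilon> M where \<epsilon>: "0 < \<epsilon>" and M: "0 < M"
    and resolvents: "\<And>\<tau>. 0 < \<tau> \<Longrightarrow> \<tau> < \<epsilon> \<Longrightarrow>
      norm (bounded_inverse (id_plus (graph_of (S \<tau>))) - resolvent K 1) \<le> M * \<tau>"
    using rate unfolding H_eq bounded_inverse_id_plus[OF K] by blast
  define a where "a = 1 + norm K"
  have a: "1 \<le> a" by (simp add: a_def)
  \<comment> \<open>below \<open>\<epsilon>'\<close> the resolvent rate is small enough for \<open>norm_inverse_difference_le\<close>; above, the gap is used\<close>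
  define \<epsilon>' where "\<epsilon>' = min (\<epsilon> / 2) (1 / (2 * a * M))"
  have \<epsilon>': "0 < \<epsilon>'" "\<epsilon>' < \<epsilon>" "a * (M * \<epsilon>') \<le> 1 / 2"
  proof -
    show "0 < \<epsilon>'" "\<epsilon>' < \<epsilon>" using \<epsilon> M a by (auto simp: \<epsilon>'_def)
    have "a * M * \<epsilon>' \<le> a * M * (1 / (2 * a * M))"
      using a M by (intro mult_left_mono) (auto simp: \<epsilon>'_def)
    then show "a * (M * \<epsilon>') \<le> 1 / 2" using a M by simp
  qed
  obtain \<delta> where \<delta>: "0 < \<delta>" "\<delta> < 1" and gap': "\<And>\<tau>. \<epsilon>' \<le> \<tau> \<Longrightarrow> op_le (F \<tau>) ((1 - \<delta>) *\<^sub>R id_blinfun)"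
    using gap \<epsilon>'(1) by meson
  \<comment> \<open>the two values bound \<open>D\<close> for \<open>\<tau>\<close> below and above \<open>\<epsilon>'\<close>\<close>
  define C where "C = max (2 * a\<^sup>2 * M + 1) (1 / \<delta> + 1 + norm K / \<epsilon>')"
  have C: "0 < C" using M by (auto simp: C_def less_max_iff_disj intro!: add_nonneg_pos)
  have F_pos: "positive_contraction (F \<tau>)" if "0 < \<tau>" for \<tau>
    using that by (intro positive_contractionI op_nonneg_imp_positive_op nonneg contraction) auto
  have main: "norm (op_power (F \<tau>) n - op_power (resolvent K \<tau>) n) \<le> 80 * C / real n"
    if \<tau>: "0 < \<tau>" and n: "1 \<le> n" for \<tau> n
  proof -
    obtain \<delta>' where "0 < \<delta>'" "\<delta>' < 1" "op_le (F \<tau>) ((1 - \<delta>') *\<^sub>R id_blinfun)"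
      using gap \<tau> by (meson order_refl)
    then have "norm (F \<tau>) < 1"
      using norm_le_of_op_le[of "F \<tau>" \<delta>'] nonneg[of \<tau>] \<tau> by simp
    then obtain A :: "'a \<Rightarrow>\<^sub>L 'a" where A: "\<And>x. A (x - F \<tau> x) = x" "\<And>x. A x - F \<tau> (A x) = x"
      and norm_A: "norm A \<le> 1 / (1 - norm (F \<tau>))"
      by (rule neumann_inverse) blast
    let ?D = "A - id_blinfun - (1 / \<tau>) *\<^sub>R K"
    have "norm ?D \<le> C"
    proof (cases "\<tau> < \<epsilon>'")
      case True
      \<comment> \<open>the inverse of \<open>S \<tau>\<close>\<close>
      define U where "U = \<tau> *\<^sub>R A"
      have "positive_op A"
      proof (rule positive_op_inverse)
        show "positive_op (id_blinfun - F \<tau>)"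
          using F_pos[OF \<tau>] by (simp add: positive_contraction_def)
        show "(id_blinfun - F \<tau>) (A x) = x" for x by (simp add: blinfun.diff_left A(2))
      qed
      then have U: "positive_op U"
        using \<tau> by (simp add: U_def positive_op_def symmetric_op_def blinfun.scaleR_left)
      have "bounded_inverse (id_plus (graph_of (S \<tau>))) = resolvent U 1"
        unfolding S_def graph_of_chernoff_quotient[where F = F and A = A, OF \<tau> A(2) A(1)] U_def[symmetric]
        by (rule bounded_inverse_id_plus[OF U])
      then have \<rho>: "norm (resolvent U 1 - resolvent K 1) \<le> M * \<tau>"
        using resolvents[OF \<tau>] True \<epsilon>'(2) by simp
      have "a * (M * \<tau>) \<le> a * (M * \<epsilon>')" using True M a by (intro mult_left_mono) auto
      then have "(1 + norm K) * (M * \<tau>) \<le> 1 / 2" using \<epsilon>'(3) unfolding a_def by linarith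
      from norm_inverse_difference_le[OF K U \<rho> this]
      have UK: "norm (U - K) \<le> 2 * a\<^sup>2 * (M * \<tau>)" by (simp add: a_def)
      have "?D = (1 / \<tau>) *\<^sub>R (U - K) - id_blinfun" using \<tau> by (simp add: U_def scaleR_diff_right)
      also have "norm \<dots> \<le> norm ((1 / \<tau>) *\<^sub>R (U - K)) + norm (id_blinfun :: 'a \<Rightarrow>\<^sub>L 'a)"
        by (rule norm_triangle_ineq4)
      also have "\<dots> \<le> 2 * a\<^sup>2 * M + 1"
      proof (rule add_mono)
        show "norm ((1 / \<tau>) *\<^sub>R (U - K)) \<le> 2 * a\<^sup>2 * M"
          unfolding norm_scaleR using UK \<tau> by (simp add: field_simps)
      qed (rule norm_blinfun_id_le)
      finally show ?thesis by (simp add: C_def)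
    next
      case False
      then have "norm (F \<tau>) \<le> 1 - \<delta>"
        using nonneg \<tau> \<delta> by (intro norm_le_of_op_le gap') auto
      then have "1 / (1 - norm (F \<tau>)) \<le> 1 / \<delta>" using \<delta> by (intro divide_left_mono mult_pos_pos) auto
      then have A\<delta>: "norm A \<le> 1 / \<delta>" using norm_A by linarith
      have "norm K / \<tau> \<le> norm K / \<epsilon>'" using False \<epsilon>'(1) \<tau> by (intro divide_left_mono) auto
      then have "norm ((1 / \<tau>) *\<^sub>R K) \<le> norm K / \<epsilon>'" using \<tau> by simp
      then have "norm ?D \<le> 1 / \<delta> + 1 + norm K / \<epsilon>'"
        by (intro norm_triangle_le_diff add_mono A\<delta> norm_blinfun_id_le)
      then show ?thesis by (simp add: C_def)
    qed
    then have "80 * norm ?D / real n \<le> 80 * C / real n" by (intro divide_right_mono) auto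
    then show ?thesis
      using contraction_power_rate[OF K \<tau> F_pos[OF \<tau>] A(2) n] by linarith
  qed
  have bound: "norm (op_power (F (t / real n)) n - exp_semigroup (op_minus H) t) \<le> (80 * C + 42) * (1 / real n)"
    if t: "0 \<le> t" and n: "1 \<le> n" for t n
  proof (cases "t = 0")
    case True
    have "op_power (id_blinfun :: 'a \<Rightarrow>\<^sub>L 'a) n = id_blinfun" by (induction n) auto
    moreover have "exp_semigroup (op_minus H) 0 = id_blinfun"
      using exp_semigroup_eq_grid[OF H_eq grid[OF zero_less_one], of 0]
        grid.grid_semigroup_0[OF grid[OF zero_less_one]] by simp
    ultimately show ?thesis using True F0 C by simp
  next
    case False
    \<comment> \<open>the grid of step \<open>t / n\<close> contains \<open>t\<close>\<close>
    define \<tau> where "\<tau> = t / real n"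
    have \<tau>: "0 < \<tau>" "t = real n * \<tau>" using t False n by (auto simp: \<tau>_def)
    have "exp_semigroup (op_minus H) t = grid_semigroup K \<tau> (real n * \<tau>)"
      using exp_semigroup_eq_grid[OF H_eq grid[OF \<tau>(1)] t] \<tau>(2) by simp
    then have "norm (op_power (resolvent K \<tau>) n - exp_semigroup (op_minus H) t) \<le> 42 / real n"
      using grid.resolvent_power_rate[OF grid[OF \<tau>(1)] n] by simp
    then have "norm ((op_power (F \<tau>) n - op_power (resolvent K \<tau>) n)
        + (op_power (resolvent K \<tau>) n - exp_semigroup (op_minus H) t)) \<le> 80 * C / real n + 42 / real n"
      by (intro norm_triangle_mono main[OF \<tau>(1) n])
    also have "\<dots> = (80 * C + 42) * (1 / real n)" by (simp add: add_divide_distrib)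
    finally show ?thesis by (simp add: \<tau>_def)
  qed
  show ?thesis
  proof (intro exI[of _ "80 * C + 42"] conjI allI impI SUP_least)
    show "0 < 80 * C + 42" using C by simp
  qed (use bound in auto)
qed

end
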